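(* Let $k\ge 0$ and $l\ge 1$ be integers and let $q\in\mathbb{C}\setminus\{0\}$ satisfy $(1)_q(2)_q\cdots(k+l)_q\neq 0$. Let $V=V_{(k+l-1,1)}$ with basis $v_2,\dots,v_{k+l+1}$, and let $\tilde\rho_{(k,l)}$ be the representation of the Hecke algebra $H_{k+l+1}$ in $V^{\wedge l}$ given by $$\tilde\rho_{(k,l)}(\sigma_p)=q^{1-l}A_l\big(\rho_{(k+l-1,1)}(\sigma_p)\otimes\dots\otimes\rho_{(k+l-1,1)}(\sigma_p)\big)A_l,\qquad 1\le p\le k+l$$ ($l$ tensor factors). Let $\iota:V^{\wedge l}\to V_{(k,l)}$ be the isomorphism of vector spaces defined by $$\iota(v_{i_1}\wedge v_{i_2}\wedge\dots\wedge v_{i_l})=v_I,\qquad I=\{i_1,\dots,i_l\},\quad 2\le i_1<i_2<\dots<i_l\le k+l+1.$$ Then $\iota$ intertwines the representations $\tilde\rho_{(k,l)}$ and $\rho_{(k,l)}$ of $H_{k+l+1}$.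
   Context: For $q\in\mathbb{C}\setminus\{0\}$ and an integer $p\ge 0$, $(p)_q=\frac{q^p-q^{-p}}{q-q^{-1}}=\sum_{j=0}^{p-1}q^{p-1-2j}$ (the last expression is used when $q^2=1$); $(0)_q=0$. The Hecke algebra $H_{n+1}$ (with parameter $q$) is the unital associative $\mathbb{C}$-algebra generated by $\sigma_1,\dots,\sigma_n$ with relations $\sigma_i\sigma_{i+1}\sigma_i=\sigma_{i+1}\sigma_i\sigma_{i+1}$, $\sigma_i\sigma_j=\sigma_j\sigma_i$ for $|i-j|>1$, $\sigma_i^2=(q-q^{-1})\sigma_i+1$. Corner representation $\rho_{(k,l)}$ of $H_{k+l+1}$: its space $V_{(k,l)}$ is the complex vector space with basis $v_I$ indexed by the $l$-element subsets $I\subset\{2,3,\dots,k+l+1\}$. For $1\le p\le k+l$: $\rho_{(k,l)}(\sigma_p)v_I=q\,v_I$ if $p,p+1\notin I$; $\rho_{(k,l)}(\sigma_p)v_I=-\frac{q^{-p}}{(p)_q}v_I+\frac{(p-1)_q}{(p)_q}v_{s_pI}$ if $p\notin I$, $p+1\in I$; $\rho_{(k,l)}(\sigma_p)v_I=\frac{q^{p}}{(p)_q}v_I+\frac{(p+1)_q}{(p)_q}v_{s_pI}$ if $p\in I$, $p+1\notin I$; $\rho_{(k,l)}(\sigma_p)v_I=-q^{-1}v_I$ if $p,p+1\in I$. Here $s_pI$ is obtained from $I$ by interchanging the numbers $p$ and $p+1$ (for $p=1$ the term with $v_{s_pI}$ has coefficient $(0)_q=0$ and is omitted). The representation $\rho_{(k+l-1,1)}$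 of the same algebra $H_{k+l+1}$ is the case of one-element subsets $I=\{i\}\subset\{2,\dots,k+l+1\}$, with $v_i:=v_{\{i\}}$. The antisymmetrizer $A_l$ on $V^{\otimes l}$ is $A_l(w_1\otimes\dots\otimes w_l)=\frac1{l!}\sum_{s\in S_l}\mathrm{sgn}(s)\,w_{s(1)}\otimes\dots\otimes w_{s(l)}$; $V^{\wedge l}:=A_lV^{\otimes l}$ and $w_1\wedge\dots\wedge w_l:=A_l(w_1\otimes\dots\otimes w_l)$. *)

theory Defs
  imports
    Complex_Main
    "HOL-Library.Poly_Mapping"
    "HOL-Combinatorics.Permutations"
    "HOL-Algebra.QuotRing"
begin

section \<open>Quantum integers\<close>

text \<open>The sum is meaningful for every nonzero q; it agrees with the quotient
  whenever the latter is defined, see the lemma below.\<close>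

definition qnum :: "complex \<Rightarrow> nat \<Rightarrow> complex" where
  "qnum q p = (\<Sum>j<p. q powi (int p - 1 - 2 * int j))"

lemma qnum_quotient:
  assumes "q \<noteq> 0" "q^2 \<noteq> 1"
  shows "qnum q p = (q powi int p - q powi (- int p)) / (q - inverse q)"
proof -
  have nz: "q - inverse q \<noteq> 0"
    using assms by (auto simp: field_simps power2_eq_square)
  have "(q - inverse q) * qnum q p =
      (\<Sum>j<p. q powi (int p - 2 * int j) - q powi (int p - 2 * int (Suc j)))"
    unfolding qnum_def sum_distrib_left
  proof (rule sum.cong[OF refl])
    fix j
    have "q * q powi (int p - 1 - 2 * int j) = q powi (1 + (int p - 1 - 2 * int j))"
      using assms(1) by (subst power_int_add) auto
    moreover have "inverse q * q powi (int p - 1 - 2 * int j) = q powi (-1 + (int p - 1 - 2 * int j))"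
      using assms(1) by (subst power_int_add) auto
    ultimately show "(q - inverse q) * q powi (int p - 1 - 2 * int j) =
        q powi (int p - 2 * int j) - q powi (int p - 2 * int (Suc j))"
      by (simp add: algebra_simps)
  qed
  also have "\<dots> = q powi int p - q powi (- int p)"
    by (subst sum_lessThan_telescope') simp
  finally show ?thesis
    using nz by (simp add: field_simps)
qed


section \<open>Free complex vector spaces\<close>

text \<open>The complex vector space with basis \<open>B\<close> is the set of finitely supported
  functions with support in \<open>B\<close>; linear maps are described by their values on the basis.\<close>

definition vscale :: "complex \<Rightarrow> ('b \<Rightarrow>\<^sub>0 complex) \<Rightarrow> ('b \<Rightarrow>\<^sub>0 complex)" where
  "vscale c x = Poly_Mapping.map ((*) c) x"

definition basis_vec :: "'b \<Rightarrow> ('b \<Rightarrow>\<^sub>0 complex)" where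
  "basis_vec b = Poly_Mapping.single b 1"

definition free_space :: "'b set \<Rightarrow> ('b \<Rightarrow>\<^sub>0 complex) set" where
  "free_space B = {x. Poly_Mapping.keys x \<subseteq> B}"

definition lin_ext :: "('b \<Rightarrow> ('c \<Rightarrow>\<^sub>0 complex)) \<Rightarrow> ('b \<Rightarrow>\<^sub>0 complex) \<Rightarrow> ('c \<Rightarrow>\<^sub>0 complex)" where
  "lin_ext f x = (\<Sum>b\<in>Poly_Mapping.keys x. vscale (Poly_Mapping.lookup x b) (f b))"

definition linear_map_on ::
    "('b \<Rightarrow>\<^sub>0 complex) set \<Rightarrow> ('c \<Rightarrow>\<^sub>0 complex) set \<Rightarrow> (('b \<Rightarrow>\<^sub>0 complex) \<Rightarrow> ('c \<Rightarrow>\<^sub>0 complex)) \<Rightarrow> bool" where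
  "linear_map_on V W f \<longleftrightarrow> f ` V \<subseteq> W \<and>
     (\<forall>x\<in>V. \<forall>y\<in>V. f (x + y) = f x + f y) \<and> (\<forall>c. \<forall>x\<in>V. f (vscale c x) = vscale c (f x))"

lemma lookup_vscale [simp]: "Poly_Mapping.lookup (vscale c x) b = c * Poly_Mapping.lookup x b"
  by (simp add: vscale_def Poly_Mapping.map.rep_eq when_def)

global_interpretation free_vs: vector_space "vscale :: complex \<Rightarrow> ('b \<Rightarrow>\<^sub>0 complex) \<Rightarrow> _"
  by unfold_locales (auto intro!: poly_mapping_eqI simp: lookup_add algebra_simps)

lemma lin_ext_superset:
  assumes "finite A" "Poly_Mapping.keys x \<subseteq> A"
  shows "lin_ext f x = (\<Sum>b\<in>A. vscale (Poly_Mapping.lookup x b) (f b))"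
  unfolding lin_ext_def using assms
  by (intro sum.mono_neutral_left) (auto simp: in_keys_iff)

lemma linear_lin_ext: "Vector_Spaces.linear vscale vscale (lin_ext f)"
proof (unfold Vector_Spaces.linear_def module_hom_def module_hom_axioms_def, intro conjI allI)
  show "vector_space (vscale :: complex \<Rightarrow> ('b \<Rightarrow>\<^sub>0 complex) \<Rightarrow> _)"
    "vector_space (vscale :: complex \<Rightarrow> ('a \<Rightarrow>\<^sub>0 complex) \<Rightarrow> _)"
    "module (vscale :: complex \<Rightarrow> ('b \<Rightarrow>\<^sub>0 complex) \<Rightarrow> _)"
    "module (vscale :: complex \<Rightarrow> ('a \<Rightarrow>\<^sub>0 complex) \<Rightarrow> _)" by unfold_locales
next
  fix x y :: "'a \<Rightarrow>\<^sub>0 complex"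
  let ?A = "Poly_Mapping.keys x \<union> Poly_Mapping.keys y"
  have "Poly_Mapping.keys (x + y) \<subseteq> ?A" by (rule keys_add)
  then show "lin_ext f (x + y) = lin_ext f x + lin_ext f y"
    by (simp add: lin_ext_superset[of ?A] lookup_add free_vs.scale_left_distrib sum.distrib)
next
  fix c and x :: "'a \<Rightarrow>\<^sub>0 complex"
  have "Poly_Mapping.keys (vscale c x) \<subseteq> Poly_Mapping.keys x" by (auto simp: in_keys_iff)
  then show "lin_ext f (vscale c x) = vscale c (lin_ext f x)"
    by (simp add: lin_ext_superset[of "Poly_Mapping.keys x"] free_vs.scale_sum_right)
qed

lemma lin_ext_basis_vec [simp]: "lin_ext f (basis_vec b) = f b"
  by (simp add: lin_ext_def basis_vec_def)


lemma lookup_lin_ext: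
  "Poly_Mapping.lookup (lin_ext f x) c =
     (\<Sum>b\<in>Poly_Mapping.keys x. Poly_Mapping.lookup x b * Poly_Mapping.lookup (f b) c)"
  by (simp add: lin_ext_def lookup_sum)

lemma linear_eq_lin_ext:
  assumes "Vector_Spaces.linear vscale vscale T"
  shows "T x = lin_ext (\<lambda>b. T (basis_vec b)) x"
proof -
  interpret T: Vector_Spaces.linear vscale vscale T by fact
  have "x = (\<Sum>b\<in>Poly_Mapping.keys x. vscale (Poly_Mapping.lookup x b) (basis_vec b))"
    by (rule poly_mapping_eqI)
      (auto simp: lookup_sum basis_vec_def lookup_single when_def if_distrib sum.If_cases
        sum.delta in_keys_iff cong: if_cong)
  then have "T x = T (\<Sum>b\<in>Poly_Mapping.keys x. vscale (Poly_Mapping.lookup x b) (basis_vec b))"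
    by simp
  also have "\<dots> = lin_ext (\<lambda>b. T (basis_vec b)) x"
    by (simp add: T.sum T.scale lin_ext_def)
  finally show ?thesis .
qed

lemma linear_comp_lin_ext:
  assumes "Vector_Spaces.linear vscale vscale T"
  shows "T (lin_ext f x) = lin_ext (\<lambda>b. T (f b)) x"
proof -
  interpret T: Vector_Spaces.linear vscale vscale T by fact
  show ?thesis by (simp add: T.sum T.scale lin_ext_def)
qed

lemma lin_ext_swap:
  "lin_ext (\<lambda>b. lin_ext (\<lambda>c. f b c) y) x = lin_ext (\<lambda>c. lin_ext (\<lambda>b. f b c) x) y"
  by (simp add: lin_ext_def free_vs.scale_sum_right mult.commute)
    (rule sum.swap)


section \<open>Tensor powers and exterior powers\<close>

text \<open>If V has basis \<open>B\<close>, then the l-th tensor power of V has as basis the lists of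
  length l over \<open>B\<close>, the list \<open>is\<close> standing for the tensor product of the basis vectors
  with the indices in \<open>is\<close>.\<close>

definition tensor_space :: "'b set \<Rightarrow> nat \<Rightarrow> ('b list \<Rightarrow>\<^sub>0 complex) set" where
  "tensor_space B l = free_space {is. length is = l \<and> set is \<subseteq> B}"

definition tensor_cons :: "('b \<Rightarrow>\<^sub>0 complex) \<Rightarrow> ('b list \<Rightarrow>\<^sub>0 complex) \<Rightarrow> ('b list \<Rightarrow>\<^sub>0 complex)" where
  "tensor_cons w t = lin_ext (\<lambda>i. lin_ext (\<lambda>is. basis_vec (i # is)) t) w"

primrec tensor :: "('b \<Rightarrow>\<^sub>0 complex) list \<Rightarrow> ('b list \<Rightarrow>\<^sub>0 complex)" where
  "tensor [] = basis_vec []"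
| "tensor (w # ws) = tensor_cons w (tensor ws)"

definition tensor_map ::
    "(('b \<Rightarrow>\<^sub>0 complex) \<Rightarrow> ('c \<Rightarrow>\<^sub>0 complex)) \<Rightarrow> ('b list \<Rightarrow>\<^sub>0 complex) \<Rightarrow> ('c list \<Rightarrow>\<^sub>0 complex)" where
  "tensor_map T = lin_ext (\<lambda>is. tensor (map (\<lambda>i. T (basis_vec i)) is))"

definition antisym :: "nat \<Rightarrow> ('b list \<Rightarrow>\<^sub>0 complex) \<Rightarrow> ('b list \<Rightarrow>\<^sub>0 complex)" where
  "antisym l = lin_ext (\<lambda>is. vscale (1 / fact l)
     (\<Sum>s | s permutes {..<l}. vscale (of_int (sign s)) (basis_vec (permute_list s is))))"

definition wedge_space :: "'b set \<Rightarrow> nat \<Rightarrow> ('b list \<Rightarrow>\<^sub>0 complex) set" where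
  "wedge_space B l = antisym l ` tensor_space B l"

definition wedge :: "('b \<Rightarrow>\<^sub>0 complex) list \<Rightarrow> ('b list \<Rightarrow>\<^sub>0 complex)" where
  "wedge ws = antisym (length ws) (tensor ws)"

lemma lookup_tensor_cons:
  "Poly_Mapping.lookup (tensor_cons w t) js =
     (case js of [] \<Rightarrow> 0 | j # js' \<Rightarrow> Poly_Mapping.lookup w j * Poly_Mapping.lookup t js')"
proof (cases js)
  case Nil
  then show ?thesis
    by (simp add: tensor_cons_def lookup_lin_ext basis_vec_def lookup_single)
next
  case (Cons j js')
  have "Poly_Mapping.lookup (tensor_cons w t) js =
      (\<Sum>i\<in>Poly_Mapping.keys w. Poly_Mapping.lookup w i *
        (\<Sum>is\<in>Poly_Mapping.keys t. if is = js' then (if i = j then Poly_Mapping.lookup t is else 0) else 0))"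
    unfolding tensor_cons_def lookup_lin_ext
    by (intro sum.cong arg_cong2[where f = "(*)"] refl)
      (auto simp: basis_vec_def lookup_single Cons when_def)
  also have "\<dots> = (\<Sum>i\<in>Poly_Mapping.keys w. if i = j then Poly_Mapping.lookup w i * Poly_Mapping.lookup t js' else 0)"
    by (intro sum.cong refl) (auto simp: in_keys_iff)
  also have "\<dots> = Poly_Mapping.lookup w j * Poly_Mapping.lookup t js'"
    by (auto simp: in_keys_iff)
  finally show ?thesis by (simp add: Cons)
qed

lemma lookup_tensor:
  "Poly_Mapping.lookup (tensor ws) is =
     (if length is = length ws then \<Prod>j<length ws. Poly_Mapping.lookup (ws ! j) (is ! j) else 0)"
proof (induction ws arbitrary: "is")
  case Nil
  then show ?case by (auto simp: basis_vec_def lookup_single)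
next
  case (Cons w ws)
  then show ?case
    by (auto simp: lookup_tensor_cons prod.lessThan_Suc_shift split: list.split simp del: prod.lessThan_Suc)
qed

text \<open>The operators above act on products of arbitrary vectors as expected.\<close>

lemma tensor_map_tensor:
  assumes "Vector_Spaces.linear vscale vscale T"
  shows "tensor_map T (tensor ws) = tensor (map T ws)"
proof (induction ws)
  case Nil
  then show ?case by (simp add: tensor_map_def)
next
  case (Cons w ws)
  let ?g = "\<lambda>is. tensor (map (\<lambda>i. T (basis_vec i)) is)"
  have lin2: "Vector_Spaces.linear vscale vscale (tensor_cons u)" for u :: "'b \<Rightarrow>\<^sub>0 complex"
    by (subst tensor_cons_def[abs_def], subst lin_ext_swap, rule linear_lin_ext)
  have lin1: "Vector_Spaces.linear vscale vscale (\<lambda>u. tensor_cons u t)" for t :: "'b list \<Rightarrow>\<^sub>0 complex"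
    unfolding tensor_cons_def by (rule linear_lin_ext)
  have "tensor_map T (tensor (w # ws)) =
      lin_ext (\<lambda>i. lin_ext (\<lambda>is. tensor_cons (T (basis_vec i)) (?g is)) (tensor ws)) w"
    by (simp add: tensor_map_def tensor_cons_def[of w] linear_comp_lin_ext[OF linear_lin_ext])
  also have "\<dots> = lin_ext (\<lambda>i. tensor_cons (T (basis_vec i)) (tensor_map T (tensor ws))) w"
    by (simp add: tensor_map_def linear_comp_lin_ext[OF lin2])
  also have "\<dots> = tensor_cons (lin_ext (\<lambda>i. T (basis_vec i)) w) (tensor_map T (tensor ws))"
    by (simp add: linear_comp_lin_ext[OF lin1])
  also have "\<dots> = tensor (map T (w # ws))"
    by (simp add: Cons linear_eq_lin_ext[OF assms, symmetric])
  finally show ?case .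
qed

lemma antisym_tensor:
  "antisym (length ws) (tensor ws) = vscale (1 / fact (length ws))
     (\<Sum>s | s permutes {..<length ws}. vscale (of_int (sign s)) (tensor (permute_list s ws)))"
    (is "_ = vscale _ (\<Sum>s | s permutes {..<?l}. _ s)")
proof (rule poly_mapping_eqI)
  fix js :: "'a list"
  let ?t = "tensor ws"
  have key: "(\<Sum>is\<in>Poly_Mapping.keys ?t. Poly_Mapping.lookup ?t is * Poly_Mapping.lookup (basis_vec (permute_list s is)) js)
      = Poly_Mapping.lookup (tensor (permute_list s ws)) js" if s: "s permutes {..<?l}" for s
  proof (cases "length js = ?l")
    case False
    then show ?thesis
      by (auto simp: lookup_tensor basis_vec_def lookup_single when_def in_keys_iff intro!: sum.neutral)
  next
    case True
    let ?is = "permute_list (inv_into UNIV s) js"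
    have inv: "inv_into UNIV s permutes {..<?l}" using s by (rule permutes_inv)
    have eq: "permute_list s is = js \<longleftrightarrow> is = ?is" if "length is = ?l" for "is"
    proof -
      have "permute_list (inv_into UNIV s) (permute_list s is) = is"
        using permute_list_compose[of "inv_into UNIV s" "is" s] inv that s
        by (simp add: permutes_inv_o)
      moreover have "permute_list s (permute_list (inv_into UNIV s) js) = js"
        using permute_list_compose[of s js "inv_into UNIV s"] s True by (simp add: permutes_inv_o)
      ultimately show ?thesis by auto
    qed
    have "(\<Sum>is\<in>Poly_Mapping.keys ?t. Poly_Mapping.lookup ?t is * Poly_Mapping.lookup (basis_vec (permute_list s is)) js) =
        (\<Sum>is\<in>Poly_Mapping.keys ?t. if is = ?is then Poly_Mapping.lookup ?t is else 0)"
      by (intro sum.cong refl)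
        (auto simp: lookup_tensor basis_vec_def lookup_single when_def in_keys_iff eq split: if_splits)
    also have "\<dots> = Poly_Mapping.lookup ?t ?is" by (auto simp: in_keys_iff)
    also have "\<dots> = (\<Prod>j<?l. Poly_Mapping.lookup (ws ! j) (?is ! j))" using True by (simp add: lookup_tensor)
    also have "\<dots> = (\<Prod>j<?l. Poly_Mapping.lookup (ws ! s j) (?is ! s j))"
      using permutes_imp_bij[OF s] by (rule prod.reindex_bij_betw[symmetric])
    also have "\<dots> = (\<Prod>j<?l. Poly_Mapping.lookup (permute_list s ws ! j) (js ! j))"
    proof (intro prod.cong refl)
      fix j assume j: "j \<in> {..<?l}"
      have "s j < ?l" using permutes_in_image[OF s] j by auto
      then show "Poly_Mapping.lookup (ws ! s j) (?is ! s j) = Poly_Mapping.lookup (permute_list s ws ! j) (js ! j)"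
        using j True by (simp add: permute_list_def permutes_inverses[OF s])
    qed
    finally show ?thesis using True by (simp add: lookup_tensor)
  qed
  have "Poly_Mapping.lookup (antisym ?l ?t) js = 1 / fact ?l * (\<Sum>s | s permutes {..<?l}. of_int (sign s) *
      (\<Sum>is\<in>Poly_Mapping.keys ?t. Poly_Mapping.lookup ?t is * Poly_Mapping.lookup (basis_vec (permute_list s is)) js))"
    unfolding antisym_def lookup_lin_ext
    by (simp add: lookup_sum sum_distrib_left sum.swap[of _ _ "Poly_Mapping.keys ?t"] mult_ac)
  also have "\<dots> = Poly_Mapping.lookup (vscale (1 / fact ?l)
      (\<Sum>s | s permutes {..<?l}. vscale (of_int (sign s)) (tensor (permute_list s ws)))) js"
    by (simp add: lookup_sum key)
  finally show "Poly_Mapping.lookup (antisym ?l ?t) js = Poly_Mapping.lookup (vscale (1 / fact ?l)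
      (\<Sum>s | s permutes {..<?l}. vscale (of_int (sign s)) (tensor (permute_list s ws)))) js" .
qed


section \<open>Hecke algebras\<close>

text \<open>Words in the generators form the free monoid under concatenation, so finitely supported
  complex functions on words form the free unital associative algebra, with the convolution
  product provided by the library.\<close>

datatype word = Word (letters: "nat list")

instantiation word :: monoid_add
begin
definition "0 = Word []"
definition "u + v = Word (letters u @ letters v)"
instance by standard (simp_all add: zero_word_def plus_word_def)
end

definition gen :: "nat \<Rightarrow> word \<Rightarrow>\<^sub>0 complex" where
  "gen i = Poly_Mapping.single (Word [i]) 1"

definition scalar :: "complex \<Rightarrow> word \<Rightarrow>\<^sub>0 complex" where
  "scalar c = Poly_Mapping.single 0 c"

definition free_algebra :: "nat \<Rightarrow> (word \<Rightarrow>\<^sub>0 complex) ring" where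
  "free_algebra n = \<lparr>carrier = {f. \<forall>w\<in>Poly_Mapping.keys f. set (letters w) \<subseteq> {1..n}},
     mult = (*), one = 1, zero = 0, add = (+)\<rparr>"

definition hecke_relators :: "complex \<Rightarrow> nat \<Rightarrow> (word \<Rightarrow>\<^sub>0 complex) set" where
  "hecke_relators q n =
     {gen i * gen (i + 1) * gen i - gen (i + 1) * gen i * gen (i + 1) | i. 1 \<le> i \<and> i + 1 \<le> n}
   \<union> {gen i * gen j - gen j * gen i | i j. i \<in> {1..n} \<and> j \<in> {1..n} \<and> \<bar>int i - int j\<bar> > 1}
   \<union> {gen i * gen i - (scalar (q - inverse q) * gen i + 1) | i. i \<in> {1..n}}"

text \<open>\<open>hecke_algebra q n\<close> has the generators with indices from 1 to n, that is,
  it is the algebra usually denoted by H with index n + 1.\<close>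

definition hecke_ideal :: "complex \<Rightarrow> nat \<Rightarrow> (word \<Rightarrow>\<^sub>0 complex) set" where
  "hecke_ideal q n = genideal (free_algebra n) (hecke_relators q n)"

definition hecke_algebra :: "complex \<Rightarrow> nat \<Rightarrow> (word \<Rightarrow>\<^sub>0 complex) set ring" where
  "hecke_algebra q n = free_algebra n Quot hecke_ideal q n"

definition hecke_class :: "complex \<Rightarrow> nat \<Rightarrow> (word \<Rightarrow>\<^sub>0 complex) \<Rightarrow> (word \<Rightarrow>\<^sub>0 complex) set" where
  "hecke_class q n f = hecke_ideal q n +>\<^bsub>free_algebra n\<^esub> f"

definition sigma :: "complex \<Rightarrow> nat \<Rightarrow> nat \<Rightarrow> (word \<Rightarrow>\<^sub>0 complex) set" where
  "sigma q n p = hecke_class q n (gen p)"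

lemma ring_free_algebra: "ring (free_algebra n)"
proof (rule ringI)
  show "abelian_group (free_algebra n)"
  proof (rule abelian_groupI)
    fix x assume "x \<in> carrier (free_algebra n)"
    then show "\<exists>y\<in>carrier (free_algebra n). y \<oplus>\<^bsub>free_algebra n\<^esub> x = \<zero>\<^bsub>free_algebra n\<^esub>"
      by (intro bexI[of _ "- x"]) (auto simp: free_algebra_def in_keys_iff)
  qed (use keys_add in \<open>fastforce simp: free_algebra_def add_ac\<close>)+
  show "monoid (free_algebra n)"
  proof (rule monoidI)
    fix x y assume "x \<in> carrier (free_algebra n)" "y \<in> carrier (free_algebra n)"
    then show "x \<otimes>\<^bsub>free_algebra n\<^esub> y \<in> carrier (free_algebra n)"
      using keys_mult[of x y] by (fastforce simp: free_algebra_def plus_word_def)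
  qed (auto simp: free_algebra_def mult.assoc zero_word_def)
qed (auto simp: free_algebra_def algebra_simps)

lemma gen_carrier: "i \<in> {1..n} \<Longrightarrow> gen i \<in> carrier (free_algebra n)"
  by (auto simp: free_algebra_def gen_def)

lemma scalar_carrier: "scalar c \<in> carrier (free_algebra n)"
  by (auto simp: free_algebra_def scalar_def zero_word_def)

lemma hecke_relators_carrier: "hecke_relators q n \<subseteq> carrier (free_algebra n)"
proof -
  interpret ring "free_algebra n" by (rule ring_free_algebra)
  have mult: "x * y \<in> carrier (free_algebra n)"
    if "x \<in> carrier (free_algebra n)" "y \<in> carrier (free_algebra n)" for x y
    using m_closed[OF that] by (simp add: free_algebra_def)
  have add: "x + y \<in> carrier (free_algebra n)"
    if "x \<in> carrier (free_algebra n)" "y \<in> carrier (free_algebra n)" for x y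
    using a_closed[OF that] by (simp add: free_algebra_def)
  have diff: "x - y \<in> carrier (free_algebra n)"
    if "x \<in> carrier (free_algebra n)" "y \<in> carrier (free_algebra n)" for x y
    using add[OF that(1), of "- y"] that(2) by (simp add: free_algebra_def)
  have one: "1 \<in> carrier (free_algebra n)"
    using one_closed by (simp add: free_algebra_def)
  show ?thesis
    by (auto simp: hecke_relators_def intro!: diff add mult one gen_carrier scalar_carrier)
qed

lemma ideal_hecke_ideal: "ideal (hecke_ideal q n) (free_algebra n)"
  unfolding hecke_ideal_def
  by (rule ring.genideal_ideal[OF ring_free_algebra hecke_relators_carrier])

lemma ring_hecke_algebra: "ring (hecke_algebra q n)"
  unfolding hecke_algebra_def by (rule ideal.quotient_is_ring[OF ideal_hecke_ideal])

text \<open>Representations on a space \<open>W\<close>, as modules over the algebra. Compatibility with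
  scalars is stated for the multiples of the unit, which includes that the unit acts as the
  identity.\<close>

definition hecke_rep ::
    "complex \<Rightarrow> nat \<Rightarrow> ('b \<Rightarrow>\<^sub>0 complex) set \<Rightarrow>
     ((word \<Rightarrow>\<^sub>0 complex) set \<Rightarrow> ('b \<Rightarrow>\<^sub>0 complex) \<Rightarrow> ('b \<Rightarrow>\<^sub>0 complex)) \<Rightarrow> bool" where
  "hecke_rep q n W \<rho> \<longleftrightarrow>
     (\<forall>h\<in>carrier (hecke_algebra q n). linear_map_on W W (\<rho> h)) \<and>
     (\<forall>g\<in>carrier (hecke_algebra q n). \<forall>h\<in>carrier (hecke_algebra q n). \<forall>w\<in>W.
        \<rho> (g \<oplus>\<^bsub>hecke_algebra q n\<^esub> h) w = \<rho> g w + \<rho> h w \<and>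
        \<rho> (g \<otimes>\<^bsub>hecke_algebra q n\<^esub> h) w = \<rho> g (\<rho> h w)) \<and>
     (\<forall>c. \<forall>w\<in>W. \<rho> (hecke_class q n (scalar c)) w = vscale c w)"


section \<open>Corner representations and their exterior power model\<close>

definition corner_index :: "nat \<Rightarrow> nat \<Rightarrow> nat set set" where
  "corner_index k l = {I. I \<subseteq> {2..k + l + 1} \<and> card I = l}"

definition corner_space :: "nat \<Rightarrow> nat \<Rightarrow> (nat set \<Rightarrow>\<^sub>0 complex) set" where
  "corner_space k l = free_space (corner_index k l)"

text \<open>The formulas for the action of the generators do not depend on \<open>k\<close> and \<open>l\<close>.
  For \<open>p = 1\<close> the index \<open>s I\<close> below contains 1, but its coefficient vanishes.\<close>

definition corner_op :: "complex \<Rightarrow> nat \<Rightarrow> (nat set \<Rightarrow>\<^sub>0 complex) \<Rightarrow> (nat set \<Rightarrow>\<^sub>0 complex)" where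
  "corner_op q p = lin_ext (\<lambda>I.
     let sI = Transposition.transpose p (p + 1) ` I in
     if p \<notin> I \<and> p + 1 \<notin> I then vscale q (basis_vec I)
     else if p \<notin> I \<and> p + 1 \<in> I then
       vscale (- (q powi (- int p) / qnum q p)) (basis_vec I)
         + vscale (qnum q (p - 1) / qnum q p) (basis_vec sI)
     else if p \<in> I \<and> p + 1 \<notin> I then
       vscale (q powi int p / qnum q p) (basis_vec I)
         + vscale (qnum q (p + 1) / qnum q p) (basis_vec sI)
     else vscale (- inverse q) (basis_vec I))"

definition corner_rep ::
    "complex \<Rightarrow> nat \<Rightarrow> nat \<Rightarrow>
     ((word \<Rightarrow>\<^sub>0 complex) set \<Rightarrow> (nat set \<Rightarrow>\<^sub>0 complex) \<Rightarrow> (nat set \<Rightarrow>\<^sub>0 complex)) \<Rightarrow> bool" where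
  "corner_rep q k l \<rho> \<longleftrightarrow> hecke_rep q (k + l) (corner_space k l) \<rho> \<and>
     (\<forall>p\<in>{1..k + l}. \<forall>w\<in>corner_space k l. \<rho> (sigma q (k + l) p) w = corner_op q p w)"

definition corner_wedge_space :: "nat \<Rightarrow> nat \<Rightarrow> (nat set list \<Rightarrow>\<^sub>0 complex) set" where
  "corner_wedge_space k l = wedge_space (corner_index (k + l - 1) 1) l"

definition wedge_op :: "complex \<Rightarrow> nat \<Rightarrow> nat \<Rightarrow> (nat set list \<Rightarrow>\<^sub>0 complex) \<Rightarrow> (nat set list \<Rightarrow>\<^sub>0 complex)" where
  "wedge_op q l p x =
     vscale (q powi (1 - int l)) (antisym l (tensor_map (corner_op q p) (antisym l x)))"

definition wedge_rep ::
    "complex \<Rightarrow> nat \<Rightarrow> nat \<Rightarrow>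
     ((word \<Rightarrow>\<^sub>0 complex) set \<Rightarrow> (nat set list \<Rightarrow>\<^sub>0 complex) \<Rightarrow> (nat set list \<Rightarrow>\<^sub>0 complex)) \<Rightarrow> bool" where
  "wedge_rep q k l \<rho> \<longleftrightarrow> hecke_rep q (k + l) (corner_wedge_space k l) \<rho> \<and>
     (\<forall>p\<in>{1..k + l}. \<forall>w\<in>corner_wedge_space k l. \<rho> (sigma q (k + l) p) w = wedge_op q l p w)"

definition corner_iota ::
    "nat \<Rightarrow> nat \<Rightarrow> ((nat set list \<Rightarrow>\<^sub>0 complex) \<Rightarrow> (nat set \<Rightarrow>\<^sub>0 complex)) \<Rightarrow> bool" where
  "corner_iota k l \<iota> \<longleftrightarrow> linear_map_on (corner_wedge_space k l) (corner_space k l) \<iota> \<and>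
     (\<forall>is. length is = l \<and> sorted_wrt (<) is \<and> set is \<subseteq> {2..k + l + 1} \<longrightarrow>
        \<iota> (wedge (map (\<lambda>i. basis_vec {i}) is)) = basis_vec (set is))"

end

theory Submission
  imports Defs
begin

text \<open>
  On the basis vectors \<open>v\<^sub>p\<close>, \<open>v\<^sub>p\<^sub>+\<^sub>1\<close> of \<open>V\<close> a generator acts by a 2 by 2 block with trace
  \<open>q - 1/q\<close> and determinant \<open>-1\<close>, and by the scalar \<open>q\<close> on the other basis vectors. In the wedge
  of \<open>v\<^sub>i\<close> for \<open>i \<in> I\<close> the latter contribute a power of \<open>q\<close> that \<open>q\<^bsup>1-l\<^esup>\<close> turns into
  \<open>q\<close>, \<open>1\<close> or \<open>1/q\<close> according to the number of elements of \<open>I\<close> among \<open>p\<close>, \<open>p + 1\<close>;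
  the remaining factor is an entry of the block, or its determinant if both belong to \<open>I\<close>. As \<open>p\<close>
  and \<open>p + 1\<close> are adjacent, exchanging one for the other keeps the indices sorted and no sign appears.

  The Hecke relations hold for the corner operators on all finite linear combinations of sets; the
  braid relation needs only trace, determinant and one identity between the blocks
  for \<open>p\<close> and \<open>p + 1\<close>. The exterior power representation is obtained by transport
  along \<open>\<iota>\<close>.
\<close>

section \<open>Linear maps on free spaces\<close>

lemma lin_add:
  assumes "Vector_Spaces.linear vscale vscale T"
  shows "T (x + y) = T x + T y"
proof -
  interpret Vector_Spaces.linear vscale vscale T by fact
  show ?thesis by (rule add)
qed

lemma lin_scale:
  assumes "Vector_Spaces.linear vscale vscale T"
  shows "T (vscale c x) = vscale c (T x)"
proof -
  interpret Vector_Spaces.linear vscale vscale T by fact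
  show ?thesis by (rule scale)
qed

lemma lin_sum:
  assumes "Vector_Spaces.linear vscale vscale T"
  shows "T (sum f A) = (\<Sum>a\<in>A. T (f a))"
proof -
  interpret Vector_Spaces.linear vscale vscale T by fact
  show ?thesis by (rule sum)
qed

lemma lin_diff:
  assumes "Vector_Spaces.linear vscale vscale T"
  shows "T (x - y) = T x - T y"
proof -
  interpret Vector_Spaces.linear vscale vscale T by fact
  show ?thesis by (rule diff)
qed

lemma linearI:
  assumes "\<And>x y. T (x + y) = T x + T y" "\<And>c x. T (vscale c x) = vscale c (T x)"
  shows "Vector_Spaces.linear vscale vscale T"
  using assms by unfold_locales auto

lemma poly_mapping_expansion:
  "x = (\<Sum>b\<in>Poly_Mapping.keys x. Poly_Mapping.single b (Poly_Mapping.lookup x b))"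
  by (rule poly_mapping_eqI)
    (auto simp: lookup_sum lookup_single when_def if_distrib sum.delta in_keys_iff cong: if_cong)

lemma linear_eqI:
  assumes "Vector_Spaces.linear vscale vscale S" "Vector_Spaces.linear vscale vscale T"
    and "\<And>b. S (basis_vec b) = T (basis_vec b)"
  shows "S x = T x"
  by (simp add: linear_eq_lin_ext[OF assms(1), of x] linear_eq_lin_ext[OF assms(2), of x] assms(3))

lemma basis_vec_in_free_space [simp]: "basis_vec b \<in> free_space B \<longleftrightarrow> b \<in> B"
  by (auto simp: basis_vec_def free_space_def)

lemma free_space_0: "0 \<in> free_space B"
  by (simp add: free_space_def)

lemma free_space_add: "x \<in> free_space B \<Longrightarrow> y \<in> free_space B \<Longrightarrow> x + y \<in> free_space B"
  using keys_add[of x y] by (auto simp: free_space_def)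

lemma free_space_scale: "x \<in> free_space B \<Longrightarrow> vscale c x \<in> free_space B"
  by (auto simp: free_space_def in_keys_iff)

lemma free_space_sum: "(\<And>a. a \<in> A \<Longrightarrow> f a \<in> free_space B) \<Longrightarrow> sum f A \<in> free_space B"
  by (induction A rule: infinite_finite_induct) (auto intro: free_space_0 free_space_add)

lemma lin_ext_in_free_space:
  assumes "x \<in> free_space B" "\<And>b. b \<in> B \<Longrightarrow> f b \<in> free_space C"
  shows "lin_ext f x \<in> free_space C"
  unfolding lin_ext_def using assms
  by (intro free_space_sum free_space_scale) (auto simp: free_space_def)

lemma lin_ext_single: "lin_ext f (Poly_Mapping.single b c) = vscale c (f b)"
  by (simp add: lin_ext_def)

section \<open>Representations from operators satisfying the Hecke relations\<close>

lemma hecke_class_hom: "hecke_class q n \<in> ring_hom (free_algebra n) (hecke_algebra q n)"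
  using ideal.rcos_ring_hom[OF ideal_hecke_ideal] by (simp add: hecke_class_def[abs_def] hecke_algebra_def)

lemma hecke_algebra_carrier: "carrier (hecke_algebra q n) = hecke_class q n ` carrier (free_algebra n)"
  by (auto simp: hecke_algebra_def FactRing_def A_RCOSETS_def' hecke_class_def)

lemma hecke_class_carrier: "f \<in> carrier (free_algebra n) \<Longrightarrow> hecke_class q n f \<in> carrier (hecke_algebra q n)"
  by (simp add: hecke_algebra_carrier)

lemma hecke_class_add:
  assumes "f \<in> carrier (free_algebra n)" "g \<in> carrier (free_algebra n)"
  shows "hecke_class q n (f + g) = hecke_class q n f \<oplus>\<^bsub>hecke_algebra q n\<^esub> hecke_class q n g"
  using ring_hom_add[OF hecke_class_hom assms] by (simp add: free_algebra_def)

lemma hecke_class_mult: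
  assumes "f \<in> carrier (free_algebra n)" "g \<in> carrier (free_algebra n)"
  shows "hecke_class q n (f * g) = hecke_class q n f \<otimes>\<^bsub>hecke_algebra q n\<^esub> hecke_class q n g"
  using ring_hom_mult[OF hecke_class_hom assms] by (simp add: free_algebra_def)

lemma free_algebra_mult_closed:
  "f \<in> carrier (free_algebra n) \<Longrightarrow> g \<in> carrier (free_algebra n) \<Longrightarrow> f * g \<in> carrier (free_algebra n)"
  using ring.ring_simprules(5)[OF ring_free_algebra, of f n g] by (simp add: free_algebra_def)

lemma free_algebra_add_closed:
  "f \<in> carrier (free_algebra n) \<Longrightarrow> g \<in> carrier (free_algebra n) \<Longrightarrow> f + g \<in> carrier (free_algebra n)"
  using ring.ring_simprules(1)[OF ring_free_algebra, of f n g] by (simp add: free_algebra_def)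

lemma free_algebra_ops:
  "f \<otimes>\<^bsub>free_algebra n\<^esub> g = f * g" "f \<oplus>\<^bsub>free_algebra n\<^esub> g = f + g"
  by (simp_all add: free_algebra_def)

text \<open>A nonempty word starts with a generator, and an element is the finite sum of its terms.
  The scalars cover the empty word with any coefficient, and also the empty sum.\<close>

lemma free_algebra_induct [consumes 1, case_names scalar gen_mult add]:
  assumes "f \<in> carrier (free_algebra n)"
    and scalar: "\<And>c. P (scalar c)"
    and gen_mult: "\<And>i f. i \<in> {1..n} \<Longrightarrow> f \<in> carrier (free_algebra n) \<Longrightarrow> P f \<Longrightarrow> P (gen i * f)"
    and add: "\<And>f g. f \<in> carrier (free_algebra n) \<Longrightarrow> g \<in> carrier (free_algebra n) \<Longrightarrow> P f \<Longrightarrow> P g \<Longrightarrow> P (f + g)"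
  shows "P f"
proof -
  have single: "Poly_Mapping.single (Word is) c \<in> carrier (free_algebra n) \<and> P (Poly_Mapping.single (Word is) c)"
    if "set is \<subseteq> {1..n}" for "is" c
    using that
  proof (induction "is")
    case Nil
    then show ?case using scalar[of c] scalar_carrier[of c n] by (simp add: scalar_def zero_word_def)
  next
    case (Cons i "is")
    have "Poly_Mapping.single (Word (i # is)) c = gen i * Poly_Mapping.single (Word is) c"
      by (simp add: gen_def mult_single plus_word_def)
    with Cons show ?case by (simp add: gen_mult free_algebra_mult_closed gen_carrier)
  qed
  have "(\<Sum>w\<in>A. Poly_Mapping.single w (Poly_Mapping.lookup f w)) \<in> carrier (free_algebra n) \<and>
      P (\<Sum>w\<in>A. Poly_Mapping.single w (Poly_Mapping.lookup f w))"
    if "finite A" "A \<subseteq> Poly_Mapping.keys f" for A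
    using that
  proof (induction A rule: finite_induct)
    case empty
    then show ?case using scalar[of 0] scalar_carrier[of 0 n] by (simp add: scalar_def)
  next
    case (insert w A)
    have "set (letters w) \<subseteq> {1..n}"
      using insert.prems assms(1) by (auto simp: free_algebra_def)
    with single[of "letters w"] insert show ?case
      by (simp add: add free_algebra_add_closed)
  qed
  from this[of "Poly_Mapping.keys f"] show ?thesis
    by (simp flip: poly_mapping_expansion)
qed

text \<open>\<open>foldr\<close> lets the last letter act first, so concatenation of words becomes
  composition of operators in the same order.\<close>

definition word_action :: "(nat \<Rightarrow> ('b \<Rightarrow>\<^sub>0 complex) \<Rightarrow> ('b \<Rightarrow>\<^sub>0 complex)) \<Rightarrow>
    (word \<Rightarrow>\<^sub>0 complex) \<Rightarrow> ('b \<Rightarrow>\<^sub>0 complex) \<Rightarrow> ('b \<Rightarrow>\<^sub>0 complex)" where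
  "word_action T f x = lin_ext (\<lambda>w. foldr T (letters w) x) f"

lemma word_action_add: "word_action T (f + g) x = word_action T f x + word_action T g x"
  unfolding word_action_def by (rule lin_add[OF linear_lin_ext])

lemma word_action_diff: "word_action T (f - g) x = word_action T f x - word_action T g x"
  unfolding word_action_def by (rule lin_diff[OF linear_lin_ext])

lemma word_action_scalar: "word_action T (scalar c) x = vscale c x"
  by (simp add: word_action_def scalar_def lin_ext_single zero_word_def)

lemma word_action_one: "word_action T 1 x = x"
  using word_action_scalar[of T 1] by (simp add: scalar_def)

lemma word_action_gen: "word_action T (gen i) x = T i x"
  by (simp add: word_action_def gen_def lin_ext_single)

lemma linear_foldr:
  assumes "\<And>i. Vector_Spaces.linear vscale vscale (T i)"
  shows "Vector_Spaces.linear vscale vscale (foldr T is)"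
proof (rule linearI)
  show "foldr T is (x + y) = foldr T is x + foldr T is y" for x y
    by (induction "is") (simp_all add: lin_add[OF assms])
  show "foldr T is (vscale c x) = vscale c (foldr T is x)" for c x
    by (induction "is") (simp_all add: lin_scale[OF assms])
qed

lemma linear_word_action:
  assumes "\<And>i. Vector_Spaces.linear vscale vscale (T i)"
  shows "Vector_Spaces.linear vscale vscale (word_action T f)"
proof (rule linearI)
  show "word_action T f (x + y) = word_action T f x + word_action T f y" for x y
    by (simp add: word_action_def lin_ext_def lin_add[OF linear_foldr[OF assms]]
        free_vs.scale_right_distrib sum.distrib)
  show "word_action T f (vscale c x) = vscale c (word_action T f x)" for c x
    by (simp add: word_action_def lin_ext_def lin_scale[OF linear_foldr[OF assms]]
        free_vs.scale_sum_right mult.commute)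
qed

text \<open>Both sides are additive in \<open>f\<close> and in \<open>g\<close>, so single terms
  suffice; for those, \<open>foldr\<close> over an appended list is a composition.\<close>

lemma word_action_mult:
  assumes "\<And>i. Vector_Spaces.linear vscale vscale (T i)"
  shows "word_action T (f * g) x = word_action T f (word_action T g x)"
proof -
  have single: "word_action T (Poly_Mapping.single u a * Poly_Mapping.single v b) x =
      word_action T (Poly_Mapping.single u a) (word_action T (Poly_Mapping.single v b) x)" for u v a b
    by (simp add: mult_single word_action_def lin_ext_single plus_word_def
        lin_scale[OF linear_foldr[OF assms]])
  have sum: "word_action T (sum h A) y = (\<Sum>a\<in>A. word_action T (h a) y)"
    for h :: "word \<Rightarrow> (word \<Rightarrow>\<^sub>0 complex)" and A y
    unfolding word_action_def by (rule lin_sum[OF linear_lin_ext])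
  show ?thesis
    by (subst (1 2) poly_mapping_expansion[of f], subst (1 2) poly_mapping_expansion[of g],
        simp only: sum_product sum single lin_sum[OF linear_word_action[OF assms]]) (rule sum.swap)
qed

locale hecke_operators =
  fixes q :: complex and n :: nat and T :: "nat \<Rightarrow> ('b \<Rightarrow>\<^sub>0 complex) \<Rightarrow> ('b \<Rightarrow>\<^sub>0 complex)"
  assumes linear_T: "Vector_Spaces.linear vscale vscale (T i)"
    and braid: "1 \<le> i \<Longrightarrow> i + 1 \<le> n \<Longrightarrow> T i (T (i + 1) (T i x)) = T (i + 1) (T i (T (i + 1) x))"
    and far_commute: "i \<in> {1..n} \<Longrightarrow> j \<in> {1..n} \<Longrightarrow> \<bar>int i - int j\<bar> > 1 \<Longrightarrow> T i (T j x) = T j (T i x)"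
    and quadratic: "i \<in> {1..n} \<Longrightarrow> T i (T i x) = vscale (q - inverse q) (T i x) + x"
begin

text \<open>The elements that act as zero on every vector form a two-sided ideal. It contains the
  relators, hence the ideal they generate.\<close>

lemma word_action_ideal:
  assumes "f \<in> hecke_ideal q n"
  shows "word_action T f x = 0"
proof -
  let ?J = "{f \<in> carrier (free_algebra n). \<forall>x. word_action T f x = 0}"
  interpret R: ring "free_algebra n" by (rule ring_free_algebra)
  note simps = word_action_add word_action_diff word_action_mult[of T, OF linear_T]
    word_action_scalar word_action_one word_action_gen
  have zero: "word_action T g 0 = 0" for g
    using lin_scale[OF linear_word_action[of T, OF linear_T], of g 0 0] by simp
  have minus: "\<ominus>\<^bsub>free_algebra n\<^esub> g = - g" if "g \<in> carrier (free_algebra n)" for g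
  proof (rule R.minus_equality)
    show "- g \<in> carrier (free_algebra n)" using that by (auto simp: free_algebra_def in_keys_iff)
  qed (use that in \<open>auto simp: free_algebra_def\<close>)
  have "ideal ?J (free_algebra n)"
  proof (rule idealI[OF ring_free_algebra])
    show "subgroup ?J (add_monoid (free_algebra n))"
    proof (rule R.add.subgroupI)
      show "?J \<noteq> {}"
        by (rule ex_in_conv[THEN iffD1], rule exI[of _ 0])
          (simp add: free_algebra_def word_action_def lin_ext_def)
      show "\<ominus>\<^bsub>free_algebra n\<^esub> g \<in> ?J" if "g \<in> ?J" for g
        using that R.a_inv_closed[of g] word_action_diff[of T 0 g]
        by (auto simp: minus word_action_def lin_ext_def)
      show "f \<oplus>\<^bsub>free_algebra n\<^esub> g \<in> ?J" if "f \<in> ?J" "g \<in> ?J" for f g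
        using that by (simp add: free_algebra_add_closed simps free_algebra_ops)
    qed auto
    show "f \<otimes>\<^bsub>free_algebra n\<^esub> g \<in> ?J" "g \<otimes>\<^bsub>free_algebra n\<^esub> f \<in> ?J"
      if "g \<in> ?J" "f \<in> carrier (free_algebra n)" for f g
      using that by (simp_all add: free_algebra_mult_closed simps zero free_algebra_ops)
  qed
  moreover have "hecke_relators q n \<subseteq> ?J"
  proof
    fix r assume r: "r \<in> hecke_relators q n"
    then have "word_action T r x = 0" for x
      using braid by (auto simp: hecke_relators_def simps far_commute quadratic)
    with r hecke_relators_carrier show "r \<in> ?J" by blast
  qed
  ultimately show ?thesis
    using assms R.genideal_minimal[of ?J] by (auto simp: hecke_ideal_def)
qed

text \<open>All members of a class of the quotient act alike on \<open>x\<close>, so the image is a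
  singleton and no representative has to be chosen.\<close>

definition hecke_action :: "(word \<Rightarrow>\<^sub>0 complex) set \<Rightarrow> ('b \<Rightarrow>\<^sub>0 complex) \<Rightarrow> ('b \<Rightarrow>\<^sub>0 complex)" where
  "hecke_action h x = the_elem ((\<lambda>f. word_action T f x) ` h)"

lemma hecke_action_class:
  assumes "f \<in> carrier (free_algebra n)"
  shows "hecke_action (hecke_class q n f) x = word_action T f x"
proof -
  have "f \<in> hecke_class q n f" unfolding hecke_class_def
    using abelian_subgroup.a_rcos_self[OF _ assms] ideal_hecke_ideal
    by (metis abelian_subgroupI3 ideal.axioms(1) ideal_def ring.is_abelian_group)
  moreover have "word_action T g x = word_action T f x" if "g \<in> hecke_class q n f" for g
    using that by (auto simp: hecke_class_def a_r_coset_def' free_algebra_def word_action_add word_action_ideal)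
  ultimately have "(\<lambda>f. word_action T f x) ` hecke_class q n f = {word_action T f x}"
    by blast
  then show ?thesis by (simp add: hecke_action_def)
qed

text \<open>The operators live on the whole ambient space. Invariance of \<open>free_space B\<close>
  under the generators passes to all elements by induction on the free algebra.\<close>

lemma hecke_rep_hecke_action:
  assumes "\<And>i x. i \<in> {1..n} \<Longrightarrow> x \<in> free_space B \<Longrightarrow> T i x \<in> free_space B"
  shows "hecke_rep q n (free_space B) hecke_action"
proof -
  have closed: "word_action T f x \<in> free_space B"
    if "f \<in> carrier (free_algebra n)" "x \<in> free_space B" for f x
    using that
    by (induction rule: free_algebra_induct)
      (auto simp: word_action_scalar word_action_mult[of T, OF linear_T] word_action_gen word_action_add
        assms free_space_scale free_space_add)
  show ?thesis
    by (auto simp: hecke_rep_def hecke_algebra_carrier linear_map_on_def hecke_action_class closed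
        lin_add[OF linear_word_action[of T, OF linear_T]] lin_scale[OF linear_word_action[of T, OF linear_T]]
        word_action_add word_action_mult[of T, OF linear_T] word_action_scalar scalar_carrier
        free_algebra_add_closed free_algebra_mult_closed
        simp flip: hecke_class_add hecke_class_mult)
qed

lemma hecke_action_sigma: "i \<in> {1..n} \<Longrightarrow> hecke_action (sigma q n i) x = T i x"
  by (simp add: sigma_def hecke_action_class gen_carrier word_action_gen)

end

text \<open>The elements of the free algebra for which the claim holds for all vectors include the
  scalars, which act by the same multiple on both sides; they are closed under sums and under left
  multiplication by generators.\<close>

lemma hecke_rep_intertwining:
  assumes \<rho>: "hecke_rep q n V \<rho>" and \<rho>': "hecke_rep q n W \<rho>'"
    and \<iota>: "linear_map_on V W \<iota>"
    and sigma: "\<And>i v. i \<in> {1..n} \<Longrightarrow> v \<in> V \<Longrightarrow> \<iota> (\<rho> (sigma q n i) v) = \<rho>' (sigma q n i) (\<iota> v)"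
    and h: "h \<in> carrier (hecke_algebra q n)" and v: "v \<in> V"
  shows "\<iota> (\<rho> h v) = \<rho>' h (\<iota> v)"
proof -
  obtain f where f: "f \<in> carrier (free_algebra n)" and hf: "h = hecke_class q n f"
    using h by (auto simp: hecke_algebra_carrier)
  have \<iota>V: "\<iota> v \<in> W" if "v \<in> V" for v
    using \<iota> that by (auto simp: linear_map_on_def)
  have \<rho>V: "\<rho> (hecke_class q n f) v \<in> V" if "f \<in> carrier (free_algebra n)" "v \<in> V" for f v
    using \<rho> hecke_class_carrier[OF that(1), of q] that(2)
    unfolding hecke_rep_def linear_map_on_def by blast
  have "\<forall>v\<in>V. \<iota> (\<rho> (hecke_class q n f) v) = \<rho>' (hecke_class q n f) (\<iota> v)"
    using f
  proof (induction rule: free_algebra_induct)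
    case (scalar c)
    then show ?case using \<rho> \<rho>' \<iota> \<iota>V by (simp add: hecke_rep_def linear_map_on_def)
  next
    case (gen_mult i f)
    have split: "\<rho> (hecke_class q n (gen i * f)) v = \<rho> (sigma q n i) (\<rho> (hecke_class q n f) v)"
      "\<rho>' (hecke_class q n (gen i * f)) (\<iota> v) = \<rho>' (sigma q n i) (\<rho>' (hecke_class q n f) (\<iota> v))"
      if "v \<in> V" for v
      using \<rho> \<rho>' \<iota>V[OF that] that gen_mult
      by (auto simp: hecke_class_mult gen_carrier hecke_class_carrier hecke_rep_def sigma_def)
    show ?case
      using gen_mult by (simp add: split sigma \<rho>V)
  next
    case (add f g)
    then show ?case
      using \<rho> \<rho>' \<iota> \<iota>V \<rho>V by (simp add: hecke_class_add hecke_class_carrier hecke_rep_def linear_map_on_def)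
  qed
  with v hf show ?thesis by blast
qed

section \<open>The Hecke relations for the corner operators\<close>

lemma qnum_0 [simp]: "qnum q 0 = 0"
  and qnum_1 [simp]: "qnum q (Suc 0) = 1"
  by (simp_all add: qnum_def)

text \<open>The summand with \<open>j = p\<close> is the power of \<open>q\<close> with exponent
  \<open>-p\<close>; the others are \<open>q\<close> times the summands of
  \<open>qnum q p\<close>.\<close>

lemma qnum_Suc:
  assumes "q \<noteq> 0"
  shows "qnum q (Suc p) = q * qnum q p + inverse q ^ p"
proof -
  have "q powi (int p - 2 * int j) = q * q powi (int p - 1 - 2 * int j)" for j
    using assms power_int_add[of q 1 "int p - 1 - 2 * int j"] by simp
  then show ?thesis
    unfolding qnum_def sum.lessThan_Suc sum_distrib_left using assms
    by (intro arg_cong2[where f = "(+)"] sum.cong refl) (simp_all add: algebra_simps power_int_minus power_inverse)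
qed

text \<open>The mirror image of \<open>qnum_Suc\<close> under exchange of \<open>q\<close> and
  \<open>1/q\<close>, a symmetry of quantum integers; obtained here from \<open>qnum_Suc\<close> by
  induction.\<close>

lemma qnum_Suc':
  assumes "q \<noteq> 0"
  shows "qnum q (Suc p) = inverse q * qnum q p + q ^ p"
proof (induction p)
  case (Suc p)
  have "inverse q * qnum q (Suc p) + q ^ Suc p = inverse q * (q * qnum q p + inverse q ^ p) + q ^ Suc p"
    by (simp only: qnum_Suc[OF assms])
  also have "\<dots> = q * (inverse q * qnum q p + q ^ p) + inverse q ^ Suc p"
    by (simp add: algebra_simps)
  finally show ?case
    by (simp only: Suc.IH[symmetric] qnum_Suc[OF assms, symmetric])
qed simp

text \<open>The Boolean arguments \<open>a\<close> and \<open>b\<close> stand for \<open>p \<in> I\<close> and \<open>p + 1 \<in> I\<close>.\<close>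

definition corner_diag :: "complex \<Rightarrow> nat \<Rightarrow> bool \<Rightarrow> bool \<Rightarrow> complex" where
  "corner_diag q p a b = (if a then if b then - inverse q else q ^ p / qnum q p
     else if b then - (inverse q ^ p / qnum q p) else q)"

definition corner_off :: "complex \<Rightarrow> nat \<Rightarrow> bool \<Rightarrow> bool \<Rightarrow> complex" where
  "corner_off q p a b = (if a = b then 0
     else if a then qnum q (p + 1) / qnum q p else qnum q (p - 1) / qnum q p)"

section \<open>Blocks of the corner operators: coefficients, trace and determinant\<close>

lemma linear_corner_op: "Vector_Spaces.linear vscale vscale (corner_op q p)"
  unfolding corner_op_def by (rule linear_lin_ext)

text \<open>One form for all cases: if \<open>p\<close> and \<open>p + 1\<close> lie both in
  \<open>I\<close> or both outside, the second coefficient is zero.\<close>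

lemma corner_op_basis_vec:
  "corner_op q p (basis_vec I) =
     vscale (corner_diag q p (p \<in> I) (p + 1 \<in> I)) (basis_vec I) +
     vscale (corner_off q p (p \<in> I) (p + 1 \<in> I)) (basis_vec (Transposition.transpose p (p + 1) ` I))"
  by (auto simp: corner_op_def Let_def corner_diag_def corner_off_def power_int_minus power_inverse)

text \<open>The difference of the two recursions for \<open>qnum q (Suc p)\<close>. It is the
  quotient formula with the denominator cleared, so it covers \<open>q^2 = 1\<close> as
  well.\<close>

lemma qnum_Suc_eq:
  assumes "q \<noteq> 0"
  shows "q ^ p - inverse q ^ p = (q - inverse q) * qnum q p"
  using qnum_Suc[OF assms, of p] qnum_Suc'[OF assms, of p] by (simp add: algebra_simps)

lemma corner_trace:
  assumes "q \<noteq> 0" "qnum q p \<noteq> 0"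
  shows "corner_diag q p a (\<not> a) + corner_diag q p (\<not> a) a = q - inverse q"
  using qnum_Suc_eq[OF assms(1), of p] assms(2)
  by (cases a) (simp_all add: corner_diag_def field_simps)

text \<open>With denominators cleared, the claim becomes
  \<open>(p+1)_q (p-1)_q = (p)_q^2 - 1\<close>.\<close>

lemma corner_det:
  assumes "q \<noteq> 0" "p \<ge> 1" "qnum q p \<noteq> 0"
  shows "corner_diag q p a (\<not> a) * corner_diag q p (\<not> a) a
    - corner_off q p a (\<not> a) * corner_off q p (\<not> a) a = - 1"
proof -
  define u v w P where "u = q ^ p" and "v = inverse q ^ p" and "w = inverse q" and "P = qnum q p"
  obtain r where r: "p = Suc r" using assms(2) by (cases p) auto
  have "P = q * qnum q r + inverse q ^ r"
    unfolding P_def r by (rule qnum_Suc[OF assms(1)])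
  \<comment> \<open>The recursion is solved for its smaller term; \<open>p \<ge> 1\<close> makes
    \<open>p - 1\<close> a true predecessor.\<close>
  then have "qnum q (p - 1) = w * P - v"
    using assms(1) by (simp add: r w_def v_def field_simps)
  then have coeffs: "corner_diag q p True False = u / P" "corner_diag q p False True = - (v / P)"
    "corner_off q p True False = (q * P + v) / P" "corner_off q p False True = (w * P - v) / P"
    using qnum_Suc[OF assms(1), of p]
    by (simp_all add: corner_diag_def corner_off_def u_def v_def P_def)
  have uv: "u * v = 1" "q * w = 1" using assms(1) by (auto simp: u_def v_def w_def simp flip: power_mult_distrib)
  have "- (u * v) - (q * P + v) * (w * P - v) =
      - (u * v) - (q * w) * (P * P) + v * ((q - w) * P) + v * v"
    by (simp add: algebra_simps)
  also have "(q - w) * P = u - v"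
    using qnum_Suc_eq[OF assms(1), of p] by (simp add: u_def v_def w_def P_def)
  finally have "- (u * v) - (q * P + v) * (w * P - v) = - (P * P)"
    using uv by (simp add: algebra_simps)
  moreover have "P \<noteq> 0" using assms(3) by (simp add: P_def)
  ultimately have "corner_diag q p True False * corner_diag q p False True
      - corner_off q p True False * corner_off q p False True = - 1"
    unfolding coeffs by (simp add: field_simps)
  then show ?thesis by (cases a) (simp_all add: mult.commute)
qed

text \<open>Clearing denominators reduces this link between neighbouring blocks to a recursion for
  \<open>R\<close>: \<open>R(1)\<close> when \<open>b\<close> is false, \<open>R(2)\<close> when
  \<open>b\<close> is true.\<close>

lemma corner_braid_coeff:
  assumes "q \<noteq> 0" "qnum q p \<noteq> 0" "qnum q (p + 1) \<noteq> 0"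
  shows "corner_diag q p b b * corner_diag q p (\<not> b) b + corner_diag q (p + 1) (\<not> b) b * corner_diag q p b (\<not> b)
    = corner_diag q p b b * corner_diag q (p + 1) (\<not> b) b"
proof -
  define u v w P R where "u = q ^ p" and "v = inverse q ^ p" and "w = inverse q" and "P = qnum q p"
    and "R = qnum q (p + 1)"
  have uv: "u * v = 1" "q * w = 1" using assms(1) by (auto simp: u_def v_def w_def simp flip: power_mult_distrib)
  have nz: "P \<noteq> 0" "R \<noteq> 0" using assms by (simp_all add: P_def R_def)
  have R: "R = q * P + v" "R = w * P + u"
    using qnum_Suc[OF assms(1)] qnum_Suc'[OF assms(1)] by (simp_all add: R_def P_def u_def v_def w_def)
  have "corner_diag q p False False = q" "corner_diag q p True True = - w"
    "corner_diag q p True False = u / P" "corner_diag q p False True = - (v / P)"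
    "corner_diag q (p + 1) True False = q * u / R" "corner_diag q (p + 1) False True = - (w * v / R)"
    by (simp_all add: corner_diag_def u_def v_def w_def P_def R_def)
  note coeffs = this
  have "u * R - u * v = u * (q * P)" "v * R - u * v = v * (w * P)"
    by (subst R(1), simp add: algebra_simps) (subst R(2), simp add: algebra_simps)
  then have "q * (u * R - u * v) = q * (u * (q * P))" "w * (v * R - u * v) = w * (v * (w * P))"
    by simp_all
  then show ?thesis
    using nz by (cases b) (simp_all only: coeffs not_True_eq_False not_False_eq_True, simp_all add: field_simps)
qed

text \<open>Cayley-Hamilton for the block on \<open>I\<close> and its image under the transposition.
  Where there is no block, the operator multiplies by \<open>q\<close> or \<open>- 1/q\<close>, the
  two roots of the same polynomial.\<close>

lemma corner_op_quadratic:
  assumes "q \<noteq> 0" "p \<ge> 1" "qnum q p \<noteq> 0"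
  shows "corner_op q p (corner_op q p x) = vscale (q - inverse q) (corner_op q p x) + x"
proof (rule linear_eqI[where S = "\<lambda>x. corner_op q p (corner_op q p x)"
      and T = "\<lambda>x. vscale (q - inverse q) (corner_op q p x) + x"])
  show "Vector_Spaces.linear vscale vscale (\<lambda>x. corner_op q p (corner_op q p x))"
    "Vector_Spaces.linear vscale vscale (\<lambda>x. vscale (q - inverse q) (corner_op q p x) + x)"
    by (rule linearI; simp add: lin_add[OF linear_corner_op] lin_scale[OF linear_corner_op]
        free_vs.scale_right_distrib mult.commute)+
next
  fix I :: "nat set"
  let ?t = "Transposition.transpose p (p + 1)"
  have t: "?t ` ?t ` I = I" by (simp add: image_comp)
  have mem: "p \<in> ?t ` I \<longleftrightarrow> p + 1 \<in> I" "p + 1 \<in> ?t ` I \<longleftrightarrow> p \<in> I"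
    by (auto simp: Transposition.transpose_def image_iff)
  note lin = lin_add[OF linear_corner_op] lin_scale[OF linear_corner_op]
  show "corner_op q p (corner_op q p (basis_vec I)) =
      vscale (q - inverse q) (corner_op q p (basis_vec I)) + basis_vec I"
    unfolding lin corner_op_basis_vec mem t
  proof (rule poly_mapping_eqI, goal_cases)
    case (1 J)
    \<comment> \<open>Cayley-Hamilton in coordinates: \<open>x\<close> and \<open>y\<close> will be
      the values at \<open>J\<close> of the basis vectors of \<open>I\<close> and of its
      image.\<close>
    have "a * (a * x + b * y) + b * (d * y + c * x) = (q - inverse q) * (a * x + b * y) + x"
      if "a + d = q - inverse q" "a * d - b * c = - 1" for a b c d x y
    proof -
      have "a * (a * x + b * y) + b * (d * y + c * x) = (a + d) * (a * x + b * y) - (a * d - b * c) * x"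
        by (simp add: algebra_simps)
      with that show ?thesis by simp
    qed
    note sq = this
    show ?case
    proof (cases "(p \<in> I) = (p + 1 \<in> I)")
      case True
      then show ?thesis using assms(1)
        by (auto simp: lookup_add corner_diag_def corner_off_def algebra_simps)
    next
      case False
      from sq[OF corner_trace[OF assms(1,3), of "p \<in> I"] corner_det[OF assms, of "p \<in> I"]] False show ?thesis
        by (simp add: lookup_add)
    qed
  qed
qed

text \<open>The two transpositions are disjoint: they commute, and neither changes the memberships
  that determine the coefficients of the other operator.\<close>

lemma corner_op_far_commute:
  assumes "\<bar>int i - int j\<bar> > 1"
  shows "corner_op q i (corner_op q j x) = corner_op q j (corner_op q i x)"
proof (rule linear_eqI[where S = "\<lambda>x. corner_op q i (corner_op q j x)"
      and T = "\<lambda>x. corner_op q j (corner_op q i x)"])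
  show "Vector_Spaces.linear vscale vscale (\<lambda>x. corner_op q i (corner_op q j x))"
    "Vector_Spaces.linear vscale vscale (\<lambda>x. corner_op q j (corner_op q i x))"
    by (rule linearI; simp add: lin_add[OF linear_corner_op] lin_scale[OF linear_corner_op])+
next
  fix I :: "nat set"
  let ?s = "Transposition.transpose i (i + 1)" and ?t = "Transposition.transpose j (j + 1)"
  define K where "K = ?s ` ?t ` I"
  have st: "?t ` ?s ` I = K"
    unfolding K_def image_image using assms by (intro image_cong refl) (auto simp: Transposition.transpose_def)
  have mem: "j \<in> ?s ` I \<longleftrightarrow> j \<in> I" "j + 1 \<in> ?s ` I \<longleftrightarrow> j + 1 \<in> I"
    "i \<in> ?t ` I \<longleftrightarrow> i \<in> I" "i + 1 \<in> ?t ` I \<longleftrightarrow> i + 1 \<in> I"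
    using assms by (auto simp: Transposition.transpose_def image_iff split: if_splits)
  show "corner_op q i (corner_op q j (basis_vec I)) = corner_op q j (corner_op q i (basis_vec I))"
    unfolding lin_add[OF linear_corner_op] lin_scale[OF linear_corner_op] corner_op_basis_vec
      mem st K_def[symmetric]
    by (rule poly_mapping_eqI) (simp add: lookup_add algebra_simps)
qed

text \<open>\<open>T\<close> has a block on \<open>x\<close>, \<open>y\<close> and \<open>S\<close>
  has one on \<open>y\<close>, \<open>z\<close>; each multiplies the remaining vector by the same
  root \<open>r\<close> of the common characteristic polynomial of the blocks. All coefficients then
  match by \<open>e\<close> and its consequences.\<close>

lemma braid_three:
  fixes S T :: "('b \<Rightarrow>\<^sub>0 complex) \<Rightarrow> ('b \<Rightarrow>\<^sub>0 complex)"
  assumes lin: "Vector_Spaces.linear vscale vscale S" "Vector_Spaces.linear vscale vscale T"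
    and T: "T x = vscale a x + vscale b y" "T y = vscale c x + vscale d y" "T z = vscale r z"
    and S: "S x = vscale r x" "S y = vscale a' y + vscale b' z" "S z = vscale c' y + vscale d' z"
    and tr: "a + d = t" "a' + d' = t" and det: "a * d - b * c = - 1" "a' * d' - b' * c' = - 1"
    and r: "r\<^sup>2 = t * r + 1" and e: "r * a + a' * d = r * a'"
  shows "T (S (T x)) = S (T (S x))" "T (S (T y)) = S (T (S y))" "T (S (T z)) = S (T (S z))"
proof -
  have bc: "b * c = a * d + 1" "b' * c' = a' * d' + 1" using det by (auto simp: algebra_simps)
  \<comment> \<open>\<open>e\<close> rewritten through the equal traces \<open>a + d\<close> and
    \<open>a' + d'\<close>.\<close>
  have e4: "d * r = a' * d + r * d'"
  proof -
    have "d * r - (a' * d + r * d') = r * (a + d) - r * (a' + d') - (r * a + a' * d - r * a')"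
      by (simp add: algebra_simps)
    then show ?thesis using e tr by simp
  qed
  \<comment> \<open>After elimination of \<open>b * c\<close>, the difference of the sides is a
    combination of the defects in \<open>e\<close>, in the equation for \<open>r\<close> and in the
    trace. \<open>e5\<close> follows likewise from \<open>e4\<close>.\<close>
  have e1: "r * a\<^sup>2 + a' * (b * c) = r\<^sup>2 * a"
  proof -
    have "r * a\<^sup>2 + a' * (b * c) = a * (r * a + a' * d) + a'"
      unfolding bc by (simp add: algebra_simps power2_eq_square)
    moreover have "r\<^sup>2 * a - (a * (r * a + a' * d) + a') = (r - a) * (r * a + a' * d - r * a')
        + a' * (r\<^sup>2 - (t * r + 1)) + a' * r * (t - (a + d))"
      by (simp add: algebra_simps power2_eq_square)
    then have "a * (r * a + a' * d) + a' = r\<^sup>2 * a" using e tr r by simp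
    ultimately show ?thesis by simp
  qed
  have e5: "r * d'\<^sup>2 + d * (b' * c') = r\<^sup>2 * d'"
  proof -
    have "r * d'\<^sup>2 + d * (b' * c') = d' * (a' * d + r * d') + d"
      unfolding bc by (simp add: algebra_simps power2_eq_square)
    moreover have "r\<^sup>2 * d' - (d' * (a' * d + r * d') + d) = (d' - r) * (d * r - (a' * d + r * d'))
        + d * (r\<^sup>2 - (t * r + 1)) + d * r * (t - (a' + d'))"
      by (simp add: algebra_simps power2_eq_square)
    then have "d' * (a' * d + r * d') + d = r\<^sup>2 * d'" using e4 tr r by simp
    ultimately show ?thesis by simp
  qed
  have e3: "r * (b * c) + d\<^sup>2 * a' = a'\<^sup>2 * d + r * (b' * c')"
  proof -
    have "r * (b * c) + d\<^sup>2 * a' - (a'\<^sup>2 * d + r * (b' * c')) =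
        d * (r * a + a' * d) - a' * (a' * d + r * d')"
      unfolding bc by (simp add: algebra_simps power2_eq_square)
    also have "\<dots> = 0" unfolding e e4[symmetric] by simp
    finally show ?thesis by simp
  qed
  \<comment> \<open>Each coordinate of a difference to be shown zero is a combination of the scalar
    identities; the multipliers \<open>X\<close>, \<open>Y\<close>, \<open>Z\<close> are built from
    coordinates of the three vectors and off-diagonal entries.\<close>
  have coeff: "P = Q" if "P - Q = X * (E1 - F1) + Y * (E2 - F2) + Z * (E3 - F3)" "E1 = F1" "E2 = F2" "E3 = F3"
    for P Q X Y Z E1 E2 E3 F1 F2 F3 :: complex
    using that by simp
  note expand = T S lin_add[OF lin(1)] lin_scale[OF lin(1)] lin_add[OF lin(2)] lin_scale[OF lin(2)]
  show "T (S (T x)) = S (T (S x))"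
  proof (rule poly_mapping_eqI)
    show "Poly_Mapping.lookup (T (S (T x))) k = Poly_Mapping.lookup (S (T (S x))) k" for k
      unfolding expand
      by (rule coeff[where Z = 0, OF _ e1 e refl, of _ _ "Poly_Mapping.lookup x k" "b * Poly_Mapping.lookup y k"])
        (simp add: lookup_add algebra_simps power2_eq_square)
  qed
  show "T (S (T y)) = S (T (S y))"
  proof (rule poly_mapping_eqI)
    show "Poly_Mapping.lookup (T (S (T y))) k = Poly_Mapping.lookup (S (T (S y))) k" for k
      unfolding expand
      by (rule coeff[OF _ e e3 e4, of _ _ "c * Poly_Mapping.lookup x k" "Poly_Mapping.lookup y k" "b' * Poly_Mapping.lookup z k"])
        (simp add: lookup_add algebra_simps power2_eq_square)
  qed
  show "T (S (T z)) = S (T (S z))"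
  proof (rule poly_mapping_eqI)
    show "Poly_Mapping.lookup (T (S (T z))) k = Poly_Mapping.lookup (S (T (S z))) k" for k
      unfolding expand
      by (rule coeff[where Z = 0, OF _ e4 e5 refl, of _ _ "c' * Poly_Mapping.lookup y k" "- Poly_Mapping.lookup z k"])
        (simp add: lookup_add algebra_simps power2_eq_square)
  qed
qed

text \<open>If \<open>p\<close>, \<open>p + 1\<close>, \<open>p + 2\<close> have equal membership in
  \<open>I\<close>, both operators multiply the basis vector by the same scalar. Otherwise exactly
  one of the three differs from the other two, and its three possible positions give the vectors
  \<open>x\<close>, \<open>y\<close>, \<open>z\<close> of \<open>braid_three\<close>.\<close>

lemma corner_op_braid:
  assumes "q \<noteq> 0" "p \<ge> 1" "qnum q p \<noteq> 0" "qnum q (p + 1) \<noteq> 0"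
  shows "corner_op q p (corner_op q (p + 1) (corner_op q p x)) =
    corner_op q (p + 1) (corner_op q p (corner_op q (p + 1) x))"
proof (rule linear_eqI[where S = "\<lambda>x. corner_op q p (corner_op q (p + 1) (corner_op q p x))"
      and T = "\<lambda>x. corner_op q (p + 1) (corner_op q p (corner_op q (p + 1) x))"])
  show "Vector_Spaces.linear vscale vscale (\<lambda>x. corner_op q p (corner_op q (p + 1) (corner_op q p x)))"
    "Vector_Spaces.linear vscale vscale (\<lambda>x. corner_op q (p + 1) (corner_op q p (corner_op q (p + 1) x)))"
    by (rule linearI; simp add: lin_add[OF linear_corner_op] lin_scale[OF linear_corner_op])+
next
  fix I :: "nat set"
  let ?T = "corner_op q p" and ?S = "corner_op q (p + 1)"
  \<comment> \<open>\<open>K b i\<close> differs from \<open>I\<close> at most in \<open>{p, p + 1, p + 2}\<close>, where \<open>i\<close> is the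
    only index whose membership is not \<open>b\<close>.\<close>
  define K where "K b i = (I - {p, p + 1, p + 2}) \<union> {j \<in> {p, p + 1, p + 2}. (j = i) \<noteq> b}" for b i
  have mem: "j \<in> K b i \<longleftrightarrow> (j = i) \<noteq> b" if "j \<in> {p, p + 1, p + 2}" for j b i
    using that by (auto simp: K_def)
  have image: "Transposition.transpose p (p + 1) ` K b p = K b (p + 1)"
    "Transposition.transpose p (p + 1) ` K b (p + 1) = K b p"
    "Transposition.transpose (p + 1) (p + 1 + 1) ` K b (p + 1) = K b (p + 2)"
    "Transposition.transpose (p + 1) (p + 1 + 1) ` K b (p + 2) = K b (p + 1)" for b
    unfolding set_eq_iff in_transpose_image_iff K_def by (auto simp: Transposition.transpose_def)
  \<comment> \<open>The scalar outside the blocks is \<open>q\<close> or \<open>- 1/q\<close>, so it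
    solves the equation required of \<open>r\<close> in \<open>braid_three\<close>.\<close>
  have outer: "corner_diag q p b b * corner_diag q p b b = (q - inverse q) * corner_diag q p b b + 1" for b
    using assms(1) by (simp add: corner_diag_def algebra_simps)
  have K: "?T (?S (?T (basis_vec (K b i)))) = ?S (?T (?S (basis_vec (K b i))))"
    if "i \<in> {p, p + 1, p + 2}" for b i
  proof -
    let ?d = "corner_diag q p" and ?o = "corner_off q p"
      and ?d' = "corner_diag q (p + 1)" and ?o' = "corner_off q (p + 1)"
    have "?T (basis_vec (K b p)) =
        vscale (?d (\<not> b) b) (basis_vec (K b p)) + vscale (?o (\<not> b) b) (basis_vec (K b (p + 1)))"
      "?T (basis_vec (K b (p + 1))) =
        vscale (?o b (\<not> b)) (basis_vec (K b p)) + vscale (?d b (\<not> b)) (basis_vec (K b (p + 1)))"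
      "?T (basis_vec (K b (p + 2))) = vscale (?d b b) (basis_vec (K b (p + 2)))"
      "?S (basis_vec (K b p)) = vscale (?d b b) (basis_vec (K b p))"
      "?S (basis_vec (K b (p + 1))) =
        vscale (?d' (\<not> b) b) (basis_vec (K b (p + 1))) + vscale (?o' (\<not> b) b) (basis_vec (K b (p + 2)))"
      "?S (basis_vec (K b (p + 2))) =
        vscale (?o' b (\<not> b)) (basis_vec (K b (p + 1))) + vscale (?d' b (\<not> b)) (basis_vec (K b (p + 2)))"
      unfolding corner_op_basis_vec image
      by (simp_all add: mem corner_off_def corner_diag_def add.commute)
    note three = braid_three[OF linear_corner_op linear_corner_op this]
    show ?thesis
      using that three[of "q - inverse q"] corner_trace[OF assms(1,3), of "\<not> b"]
        corner_trace[OF assms(1,4), of "\<not> b"] corner_det[OF assms(1-3), of "\<not> b"]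
        corner_det[OF assms(1) _ assms(4), of "\<not> b"] corner_braid_coeff[OF assms(1,3,4), of b]
        outer[of b]
      by (auto simp: power2_eq_square)
  qed
  show "?T (?S (?T (basis_vec I))) = ?S (?T (?S (basis_vec I)))"
  proof (cases "\<exists>b. \<exists>i\<in>{p, p + 1, p + 2}. I = K b i")
    case True
    with K show ?thesis by blast
  next
    case False
    \<comment> \<open>As \<open>I\<close> is no \<open>K b i\<close>, every pattern with a single
      exception fails somewhere; the six instances below leave only equal memberships.\<close>
    have "\<exists>j\<in>{p, p + 1, p + 2}. (j \<in> I) = ((j = i) = b)" if "i \<in> {p, p + 1, p + 2}" for b i
    proof (rule ccontr)
      assume neg: "\<not> ?thesis"
      have "x \<in> I \<longleftrightarrow> x \<in> K b i" for x
      proof (cases "x \<in> {p, p + 1, p + 2}")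
        case True
        then show ?thesis using neg mem[OF True, of b i] by blast
      next
        case False
        then show ?thesis unfolding K_def by blast
      qed
      with False that show False by blast
    qed
    from this[of p True] this[of p False] this[of "p + 1" True] this[of "p + 1" False]
      this[of "p + 2" True] this[of "p + 2" False]
    have "(p \<in> I) = (p + 1 \<in> I)" "(p + 1 \<in> I) = (p + 2 \<in> I)"
      by auto
    then show ?thesis
      by (simp add: corner_op_basis_vec lin_scale[OF linear_corner_op] corner_off_def corner_diag_def)
  qed
qed

lemma hecke_operators_corner_op:
  assumes "q \<noteq> 0" "(\<Prod>p = 1..n. qnum q p) \<noteq> 0"
  shows "hecke_operators q n (corner_op q)"
proof -
  have "qnum q p \<noteq> 0" if "p \<in> {1..n}" for p
    using assms(2) that by simp
  then show ?thesis using assms(1)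
    by (intro hecke_operators.intro linear_corner_op)
      (auto simp: corner_op_far_commute corner_op_quadratic corner_op_braid[unfolded Suc_eq_plus1[symmetric]])
qed

text \<open>Only \<open>p = 1\<close> could lead out of the index set, by sending 2 to 1; the
  coefficient of that term contains \<open>qnum q 0 = 0\<close>.\<close>

lemma corner_op_closed:
  assumes "p \<in> {1..k + l}" "x \<in> corner_space k l"
  shows "corner_op q p x \<in> corner_space k l"
proof -
  have "corner_op q p (basis_vec I) \<in> free_space (corner_index k l)" if I: "I \<in> corner_index k l" for I
  proof -
    let ?t = "Transposition.transpose p (p + 1)"
    have card: "card (?t ` I) = card I"
      by (rule card_image) (rule inj_on_subset[OF inj_transpose], simp)
    have "?t ` I \<in> corner_index k l" if "corner_off q p (p \<in> I) (p + 1 \<in> I) \<noteq> 0"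
    proof -
      have "p \<noteq> 1 \<or> p + 1 \<notin> I"
        using I that by (auto simp: corner_off_def corner_index_def split: if_splits)
      then have "?t x \<in> {2..k + l + 1}" if "x \<in> I" for x
        using I assms(1) that by (cases "p = 1") (auto simp: corner_index_def Transposition.transpose_def)
      then show ?thesis
        using I card by (auto simp: corner_index_def)
    qed
    then show ?thesis
      unfolding corner_op_basis_vec using I
      by (cases "corner_off q p (p \<in> I) (p + 1 \<in> I) = 0")
        (auto intro!: free_space_add free_space_scale)
  qed
  then show ?thesis
    using assms(2) unfolding corner_space_def
    by (subst linear_eq_lin_ext[OF linear_corner_op]) (rule lin_ext_in_free_space)
qed

section \<open>Wedge products and the basis of the exterior power\<close>

lemma linear_antisym: "Vector_Spaces.linear vscale vscale (antisym l)"
  unfolding antisym_def by (rule linear_lin_ext)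

lemma linear_tensor_map: "Vector_Spaces.linear vscale vscale (tensor_map T)"
  unfolding tensor_map_def by (rule linear_lin_ext)

lemma tensor_cons_add:
  "tensor_cons (x + y) t = tensor_cons x t + tensor_cons y t"
  "tensor_cons x (t + u) = tensor_cons x t + tensor_cons x u"
  by (rule poly_mapping_eqI; simp add: lookup_tensor_cons lookup_add algebra_simps split: list.split)+

lemma tensor_cons_scale:
  "tensor_cons (vscale c x) t = vscale c (tensor_cons x t)"
  "tensor_cons x (vscale c t) = vscale c (tensor_cons x t)"
  by (rule poly_mapping_eqI; simp add: lookup_tensor_cons split: list.split)+

lemma wedge_add: "wedge (us @ (x + y) # vs) = wedge (us @ x # vs) + wedge (us @ y # vs)"
proof -
  have "tensor (us @ (x + y) # vs) = tensor (us @ x # vs) + tensor (us @ y # vs)"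
    by (induction us) (simp_all add: tensor_cons_add)
  then show ?thesis by (simp add: wedge_def lin_add[OF linear_antisym])
qed

lemma wedge_scale_all:
  "wedge (map (\<lambda>i. vscale (c i) (f i)) is) = vscale (prod_list (map c is)) (wedge (map f is))"
proof -
  have "tensor (map (\<lambda>i. vscale (c i) (f i)) is) = vscale (prod_list (map c is)) (tensor (map f is))"
    by (induction "is") (simp_all add: tensor_cons_scale)
  then show ?thesis by (simp add: wedge_def lin_scale[OF linear_antisym])
qed

lemma wedge_scale: "wedge (us @ vscale c x # vs) = vscale c (wedge (us @ x # vs))"
proof -
  have "tensor (us @ vscale c x # vs) = vscale c (tensor (us @ x # vs))"
    by (induction us) (simp_all add: tensor_cons_scale)
  then show ?thesis by (simp add: wedge_def lin_scale[OF linear_antisym])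
qed

text \<open>The antisymmetrizing sum is reindexed by composition with \<open>s\<close>; signs are
  multiplicative and \<open>sign s\<close> is its own inverse.\<close>

lemma wedge_permute_list:
  assumes s: "s permutes {..<length ws}"
  shows "wedge (permute_list s ws) = vscale (of_int (sign s)) (wedge ws)"
proof -
  let ?P = "{t. t permutes {..<length ws}}"
  have "(\<Sum>t\<in>?P. vscale (of_int (sign t)) (tensor (permute_list t (permute_list s ws)))) =
      (\<Sum>t\<in>?P. vscale (of_int (sign s)) (vscale (of_int (sign (s \<circ> t))) (tensor (permute_list (s \<circ> t) ws))))"
  proof (rule sum.cong[OF refl])
    fix t assume "t \<in> ?P"
    then have t: "t permutes {..<length ws}" by simp
    have "sign (s \<circ> t) = sign s * sign t"
      using s t by (intro sign_compose permutes_imp_permutation[OF finite_lessThan])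
    then have "sign s * sign (s \<circ> t) = sign t" by (simp flip: mult.assoc)
    then show "vscale (of_int (sign t)) (tensor (permute_list t (permute_list s ws))) =
        vscale (of_int (sign s)) (vscale (of_int (sign (s \<circ> t))) (tensor (permute_list (s \<circ> t) ws)))"
      by (simp add: permute_list_compose[OF t] flip: of_int_mult)
  qed
  also have "\<dots> = vscale (of_int (sign s)) (\<Sum>t\<in>?P. vscale (of_int (sign t)) (tensor (permute_list t ws)))"
    by (subst setum_permutations_compose_left[OF s]) (simp only: free_vs.scale_sum_right)
  finally show ?thesis
    using antisym_tensor[of "permute_list s ws"] antisym_tensor[of ws]
    by (simp add: wedge_def mult.commute)
qed

lemma permute_list_transpose_length:
  "permute_list (Transposition.transpose (length us) (length us + 1 + length ms)) (us @ x # ms @ y # vs) = us @ y # ms @ x # vs"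
    (is "?l = ?r")
proof (rule nth_equalityI)
  fix i assume i: "i < length ?l"
  let ?t = "Transposition.transpose (length us) (length us + 1 + length ms)"
  have nth: "?l ! i = (us @ x # ms @ y # vs) ! ?t i"
    using i by (simp add: permute_list_def del: upt_Suc)
  consider "i < length us" | "i = length us" | "length us < i" "i < length us + 1 + length ms"
    | "i = length us + 1 + length ms" | "length us + 1 + length ms < i"
    by linarith
  then show "?l ! i = ?r ! i"
    unfolding nth by cases (auto simp: Transposition.transpose_def nth_append nth_Cons')
qed simp

lemma wedge_swap: "wedge (us @ y # ms @ x # vs) = - wedge (us @ x # ms @ y # vs)"
proof -
  let ?s = "Transposition.transpose (length us) (length us + 1 + length ms)"
  have "?s permutes {..<length (us @ x # ms @ y # vs)}"
    by (rule permutes_swap_id) auto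
  from wedge_permute_list[OF this] show ?thesis
    by (simp only: permute_list_transpose_length) (simp add: sign_swap_id)
qed

text \<open>Exchanging two equal factors changes nothing and yet negates the wedge, so every
  coordinate equals its negative.\<close>

lemma wedge_eq_0: "\<not> distinct ws \<Longrightarrow> wedge ws = 0"
proof -
  assume "\<not> distinct ws"
  then obtain us ms vs x where ws: "ws = us @ [x] @ ms @ [x] @ vs"
    using not_distinct_decomp by blast
  have "Poly_Mapping.lookup (wedge ws) js = 0" for js
    using arg_cong[OF wedge_swap[of us x ms x vs], of "\<lambda>t. Poly_Mapping.lookup t js"]
    by (simp add: ws)
  then show ?thesis by (intro poly_mapping_eqI) simp
qed

lemma tensor_basis_vec: "tensor (map basis_vec is) = basis_vec is"
  by (induction "is") (simp_all add: tensor_cons_def)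

lemma antisym_basis_vec: "antisym (length is) (basis_vec is) = wedge (map basis_vec is)"
  by (simp add: wedge_def tensor_basis_vec)

text \<open>A tensor power of one map commutes with permutations of the factors, hence with
  antisymmetrization.\<close>

lemma tensor_map_wedge:
  assumes "Vector_Spaces.linear vscale vscale T"
  shows "tensor_map T (wedge ws) = wedge (map T ws)"
proof -
  have "tensor_map T (tensor (permute_list s ws)) = tensor (permute_list s (map T ws))"
    if "s permutes {..<length ws}" for s
    using that by (simp add: tensor_map_tensor[OF assms] permute_list_map)
  then show ?thesis
    using antisym_tensor[of ws] antisym_tensor[of "map T ws"]
    by (simp add: wedge_def lin_scale[OF linear_tensor_map] lin_sum[OF linear_tensor_map])
qed

text \<open>By alternation, each of the \<open>fact l\<close> summands equals the wedge itself,
  where \<open>l\<close> is the number of factors.\<close>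

lemma antisym_wedge: "antisym (length ws) (wedge ws) = wedge ws"
proof -
  let ?P = "{s. s permutes {..<length ws}}"
  have "antisym (length ws) (wedge ws) =
      vscale (1 / fact (length ws)) (\<Sum>s\<in>?P. vscale (of_int (sign s)) (wedge (permute_list s ws)))"
    using antisym_tensor[of ws]
    by (simp add: wedge_def lin_scale[OF linear_antisym] lin_sum[OF linear_antisym])
  also have "(\<Sum>s\<in>?P. vscale (of_int (sign s)) (wedge (permute_list s ws))) = (\<Sum>s\<in>?P. wedge ws)"
    by (intro sum.cong refl) (simp add: wedge_permute_list flip: of_int_mult)
  also have "\<dots> = vscale (of_nat (card ?P)) (wedge ws)"
    by (rule poly_mapping_eqI) (simp add: lookup_sum)
  finally show ?thesis by (simp add: card_permutations[of _ "length ws"])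
qed

text \<open>Wedges are fixed by \<open>antisym\<close>, so both antisymmetrizers in
  \<open>wedge_op\<close> disappear.\<close>

lemma wedge_op_wedge:
  "wedge_op q (length ws) p (wedge ws) = vscale (q powi (1 - int (length ws))) (wedge (map (corner_op q p) ws))"
  using antisym_wedge[of "map (corner_op q p) ws"]
  by (simp add: wedge_op_def antisym_wedge tensor_map_wedge linear_corner_op)

lemma linear_wedge_op: "Vector_Spaces.linear vscale vscale (wedge_op q l p)"
  by (rule linearI) (simp_all add: wedge_op_def lin_add[OF linear_antisym] lin_add[OF linear_tensor_map]
      lin_scale[OF linear_antisym] lin_scale[OF linear_tensor_map] free_vs.scale_right_distrib mult.commute)

section \<open>Increasing wedges as a basis of the exterior power\<close>

definition wedge_basis :: "nat set \<Rightarrow> (nat set list \<Rightarrow>\<^sub>0 complex)" where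
  "wedge_basis I = wedge (map (\<lambda>i. basis_vec {i}) (sorted_list_of_set I))"

text \<open>The sorted list of \<open>J\<close> is a permutation of that of \<open>I\<close> only if
  \<open>I = J\<close>, and then only by the identity, as the entries are distinct. What remains is
  the factor of the antisymmetrizer.\<close>

lemma lookup_wedge_basis:
  assumes "finite I" "finite J" "card I = l" "card J = l"
  shows "Poly_Mapping.lookup (wedge_basis I) (map (\<lambda>i. {i}) (sorted_list_of_set J)) =
    (if I = J then 1 / fact l else 0)"
proof -
  let ?is = "sorted_list_of_set I" and ?js = "sorted_list_of_set J"
  have inj: "inj (\<lambda>i::nat. {i})" by (rule injI) simp
  have perm: "permute_list s (map (\<lambda>i. {i}) ?is) = map (\<lambda>i. {i}) ?js \<longleftrightarrow> I = J \<and> s = id"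
    if s: "s permutes {..<length ?is}" for s
  proof
    assume "permute_list s (map (\<lambda>i. {i}) ?is) = map (\<lambda>i. {i}) ?js"
    then have eq: "permute_list s ?is = ?js"
      using s by (simp add: permute_list_map inj_map_eq_map[OF inj])
    then have "set ?is = set ?js" using s by (metis set_permute_list)
    with assms have IJ: "I = J" by simp
    have "s i = id i" for i
    proof (cases "i < length ?is")
      case True
      then have "?is ! s i = ?is ! i" "s i < length ?is"
        using eq s IJ permute_list_nth[OF s] permutes_in_image[OF s, of i] by (metis, simp)
      with True show ?thesis using nth_eq_iff_index_eq[of ?is "s i" i] by simp
    qed (use s in \<open>auto simp: permutes_def\<close>)
    with IJ show "I = J \<and> s = id" by auto
  qed simp
  have "wedge_basis I = antisym (length ?is) (basis_vec (map (\<lambda>i. {i}) ?is))"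
    using antisym_basis_vec[of "map (\<lambda>i. {i}) ?is"] by (simp add: wedge_basis_def comp_def)
  also have "\<dots> = vscale (1 / fact l) (\<Sum>s | s permutes {..<length ?is}.
      vscale (of_int (sign s)) (basis_vec (permute_list s (map (\<lambda>i. {i}) ?is))))"
    using assms by (simp add: antisym_def)
  finally have "Poly_Mapping.lookup (wedge_basis I) (map (\<lambda>i. {i}) ?js) = 1 / fact l *
      (\<Sum>s | s permutes {..<length ?is}. if s = id then if I = J then 1 else 0 else 0)"
    by (auto simp: lookup_sum basis_vec_def lookup_single when_def perm intro!: sum.cong)
  also have "\<dots> = (if I = J then 1 / fact l else 0)"
    by (simp add: sum.delta finite_permutations permutes_id)
  finally show ?thesis .
qed

text \<open>The inverse of \<open>\<iota>\<close>, convenient because it is linear on the whole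
  ambient space.\<close>

definition wedge_expand :: "(nat set \<Rightarrow>\<^sub>0 complex) \<Rightarrow> (nat set list \<Rightarrow>\<^sub>0 complex)" where
  "wedge_expand = lin_ext wedge_basis"

lemma linear_wedge_expand: "Vector_Spaces.linear vscale vscale wedge_expand"
  unfolding wedge_expand_def by (rule linear_lin_ext)

lemma corner_index_finite: "I \<in> corner_index k l \<Longrightarrow> finite I"
  by (auto simp: corner_index_def intro: finite_subset)

text \<open>The coefficient of \<open>z\<close> at \<open>J\<close> is \<open>fact l\<close> times
  that of \<open>wedge_expand z\<close> at the sorted tensor of \<open>J\<close>.\<close>

lemma inj_on_wedge_expand: "inj_on wedge_expand (corner_space k l)"
proof (rule inj_onI)
  have coeff: "Poly_Mapping.lookup (wedge_expand z) (map (\<lambda>i. {i}) (sorted_list_of_set J)) =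
      Poly_Mapping.lookup z J / fact l"
    if z: "z \<in> corner_space k l" and J: "J \<in> corner_index k l" for z J
  proof -
    have I: "I \<in> corner_index k l" if "I \<in> Poly_Mapping.keys z" for I
      using z that by (auto simp: corner_space_def free_space_def)
    have "Poly_Mapping.lookup (wedge_expand z) (map (\<lambda>i. {i}) (sorted_list_of_set J)) =
        (\<Sum>I\<in>Poly_Mapping.keys z. Poly_Mapping.lookup z I * (if I = J then 1 / fact l else 0))"
      unfolding wedge_expand_def lookup_lin_ext
    proof (intro sum.cong refl arg_cong2[where f = "(*)"] lookup_wedge_basis)
      fix I assume "I \<in> Poly_Mapping.keys z"
      from I[OF this] J show "finite I" "finite J" "card I = l" "card J = l"
        by (auto intro: corner_index_finite simp: corner_index_def)
    qed
    also have "\<dots> = (\<Sum>I\<in>Poly_Mapping.keys z. if I = J then Poly_Mapping.lookup z J / fact l else 0)"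
      by (intro sum.cong refl) auto
    finally show ?thesis by (simp add: in_keys_iff split: if_splits)
  qed
  fix x y assume xy: "x \<in> corner_space k l" "y \<in> corner_space k l" "wedge_expand x = wedge_expand y"
  show "x = y"
  proof (rule poly_mapping_eqI)
    fix J
    show "Poly_Mapping.lookup x J = Poly_Mapping.lookup y J"
    proof (cases "J \<in> corner_index k l")
      case True
      with coeff[OF xy(1)] coeff[OF xy(2)] xy(3) show ?thesis by simp
    next
      case False
      then have "J \<notin> Poly_Mapping.keys x" "J \<notin> Poly_Mapping.keys y"
        using xy by (auto simp: corner_space_def free_space_def)
      then show ?thesis by (simp add: in_keys_iff)
    qed
  qed
qed

text \<open>The antisymmetrized basis tensors span the exterior power; each is zero if an index
  repeats, and otherwise a sign times an increasing wedge.\<close>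

lemma wedge_space_eq:
  assumes "l \<ge> 1"
  shows "corner_wedge_space k l = wedge_expand ` corner_space k l"
proof
  have lin_ext_cong: "lin_ext f x = lin_ext g x" if "\<And>b. b \<in> Poly_Mapping.keys x \<Longrightarrow> f b = g b"
    for f g :: "'c \<Rightarrow> ('d \<Rightarrow>\<^sub>0 complex)" and x
    using that by (simp add: lin_ext_def)
  \<comment> \<open>\<open>l \<ge> 1\<close> makes \<open>(k + l - 1) + 1\<close> equal to
    \<open>k + l\<close>, so the basis indices of \<open>V\<close> run through
    \<open>{2..k + l + 1}\<close>.\<close>
  have one: "corner_index (k + l - 1) 1 = (\<lambda>i. {i}) ` {2..k + l + 1}"
    using assms by (auto simp: corner_index_def card_1_singleton_iff)
  define L where "L = {is. length is = l \<and> set is \<subseteq> corner_index (k + l - 1) 1}"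
  have in_range: "antisym l (basis_vec is) \<in> wedge_expand ` corner_space k l" if "is \<in> L" for "is"
  proof -
    have "is \<in> lists ((\<lambda>i. {i}) ` {2..k + l + 1})"
      using that unfolding L_def one by auto
    then obtain ns where ns: "is = map (\<lambda>i. {i}) ns" "set ns \<subseteq> {2..k + l + 1}"
      by (auto simp: lists_image)
    with that have len: "length ns = l" by (simp add: L_def)
    have wedge: "antisym l (basis_vec is) = wedge (map (\<lambda>i. basis_vec {i}) ns)"
      using antisym_basis_vec[of "is"] ns len by (simp add: comp_def)
    show ?thesis
    proof (cases "distinct ns")
      case False
      then have "antisym l (basis_vec is) = wedge_expand 0"
        unfolding wedge by (subst wedge_eq_0) (auto simp: distinct_map wedge_expand_def lin_ext_def)
      then show ?thesis by (auto simp: corner_space_def free_space_0)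
    next
      case True
      let ?ms = "sorted_list_of_set (set ns)"
      \<comment> \<open>The sign is that of a permutation carrying the sorted list to
        \<open>ns\<close>.\<close>
      have "mset ns = mset ?ms" using True by (simp add: sorted_list_of_set_sort_remdups distinct_remdups_id)
      then obtain s where s: "s permutes {..<length ?ms}" "permute_list s ?ms = ns"
        by (rule mset_eq_permutation)
      then have "wedge (map (\<lambda>i. basis_vec {i}) ns) = vscale (of_int (sign s)) (wedge_basis (set ns))"
        using wedge_permute_list[of s "map (\<lambda>i. basis_vec {i}) ?ms"]
        by (simp add: permute_list_map wedge_basis_def)
      then have "antisym l (basis_vec is) = wedge_expand (vscale (of_int (sign s)) (basis_vec (set ns)))"
        by (simp add: wedge lin_scale[OF linear_wedge_expand]) (simp add: wedge_expand_def)
      moreover have "set ns \<in> corner_index k l"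
        using ns True len by (simp add: corner_index_def distinct_card)
      ultimately show ?thesis by (auto simp: corner_space_def intro!: free_space_scale)
    qed
  qed
  show "corner_wedge_space k l \<subseteq> wedge_expand ` corner_space k l"
  proof
    fix x assume "x \<in> corner_wedge_space k l"
    then obtain y where y: "x = antisym l y" "y \<in> free_space L"
      by (auto simp: corner_wedge_space_def wedge_space_def tensor_space_def L_def)
    \<comment> \<open>Preimages chosen for basis tensors extend linearly to a preimage of
      \<open>x\<close>.\<close>
    obtain g where g: "\<And>is. is \<in> L \<Longrightarrow> g is \<in> corner_space k l \<and> antisym l (basis_vec is) = wedge_expand (g is)"
      using in_range unfolding image_iff by metis
    have "x = lin_ext (\<lambda>is. wedge_expand (g is)) y"
      unfolding y(1) linear_eq_lin_ext[OF linear_antisym, of l y]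
      using y(2) g by (intro lin_ext_cong) (auto simp: free_space_def)
    also have "\<dots> = wedge_expand (lin_ext g y)"
      by (rule linear_comp_lin_ext[OF linear_wedge_expand, symmetric])
    finally show "x \<in> wedge_expand ` corner_space k l"
      using y(2) g lin_ext_in_free_space[of y L g] by (auto simp: corner_space_def)
  qed
  show "wedge_expand ` corner_space k l \<subseteq> corner_wedge_space k l"
  proof (rule image_subsetI)
    fix z assume z: "z \<in> corner_space k l"
    let ?g = "\<lambda>I. basis_vec (map (\<lambda>i. {i}) (sorted_list_of_set I))"
    have "wedge_basis I = antisym l (?g I)" if "I \<in> corner_index k l" for I
      using antisym_basis_vec[of "map (\<lambda>i. {i}) (sorted_list_of_set I)"] that
      by (simp add: wedge_basis_def comp_def corner_index_def)
    then have "wedge_expand z = lin_ext (\<lambda>I. antisym l (?g I)) z"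
      unfolding wedge_expand_def using z
      by (intro lin_ext_cong) (auto simp: corner_space_def free_space_def)
    also have "\<dots> = antisym l (lin_ext ?g z)"
      by (rule linear_comp_lin_ext[OF linear_antisym, symmetric])
    finally have "wedge_expand z = antisym l (lin_ext ?g z)" .
    moreover have "map (\<lambda>i. {i}) (sorted_list_of_set I) \<in> L" if "I \<in> corner_index k l" for I
      using that corner_index_finite[OF that] unfolding L_def one by (auto simp: corner_index_def)
    then have "lin_ext ?g z \<in> free_space L"
      using z unfolding corner_space_def by (intro lin_ext_in_free_space) auto
    ultimately show "wedge_expand z \<in> corner_wedge_space k l"
      by (auto simp: corner_wedge_space_def wedge_space_def tensor_space_def L_def)
  qed
qed

section \<open>Intertwining\<close>

text \<open>By multilinearity each factor outside \<open>K\<close> releases one \<open>q\<close>.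
  With \<open>K = {p, p + 1}\<close> only the factors of the block remain.\<close>

lemma wedge_map_scale_outside:
  assumes "set us \<inter> K = {}" "set vs \<inter> K = {}" "set ms \<subseteq> K"
    and "\<And>i. i \<notin> K \<Longrightarrow> f i = vscale q (g i)"
  shows "wedge (map f (us @ ms @ vs)) =
    vscale (q ^ (length us + length vs)) (wedge (map g us @ map f ms @ map g vs))"
proof -
  let ?c = "\<lambda>i. if i \<in> K then 1 else q" and ?h = "\<lambda>i. if i \<in> K then f i else g i"
  have "map f (us @ ms @ vs) = map (\<lambda>i. vscale (?c i) (?h i)) (us @ ms @ vs)"
    using assms(4) by auto
  then have "wedge (map f (us @ ms @ vs)) = wedge (map (\<lambda>i. vscale (?c i) (?h i)) (us @ ms @ vs))"
    by (rule arg_cong)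
  also have "\<dots> = vscale (prod_list (map ?c (us @ ms @ vs))) (wedge (map ?h (us @ ms @ vs)))"
    by (rule wedge_scale_all)
  also have "map ?c (us @ ms @ vs) = replicate (length us) q @ replicate (length ms) 1 @ replicate (length vs) q"
    using assms(1-3) by (auto simp: map_replicate_const[symmetric] intro!: map_cong)
  also have "map ?h (us @ ms @ vs) = map g us @ map f ms @ map g vs"
    using assms(1-3) by (auto intro!: map_cong)
  finally show ?thesis
    by (simp add: prod_list_replicate power_add)
qed

text \<open>In the bilinear expansion the squares of \<open>x\<close> and \<open>y\<close> vanish,
  and the mixed terms differ by a sign.\<close>

lemma wedge_det_two:
  "wedge (us @ (vscale a x + vscale b y) # (vscale c x + vscale d y) # vs) =
    vscale (a * d - b * c) (wedge (us @ x # y # vs))"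
proof -
  have add2: "wedge (us @ z # (u + v) # vs) = wedge (us @ z # u # vs) + wedge (us @ z # v # vs)"
    and scale2: "wedge (us @ z # vscale r u # vs) = vscale r (wedge (us @ z # u # vs))" for z u v r
    using wedge_add[of "us @ [z]"] wedge_scale[of "us @ [z]"] by simp_all
  have zero: "wedge (us @ z # z # vs) = 0" for z
    by (rule wedge_eq_0) simp
  have swap: "wedge (us @ y # x # vs) = - wedge (us @ x # y # vs)"
    using wedge_swap[of us y "[]" x vs] by simp
  show ?thesis
    unfolding wedge_add wedge_scale add2 scale2 zero swap
    by (rule poly_mapping_eqI) (simp add: lookup_add algebra_simps)
qed

lemma corner_op_singleton:
  "corner_op q p (basis_vec {i}) =
     (if i = p then vscale (corner_diag q p True False) (basis_vec {p}) +
        vscale (corner_off q p True False) (basis_vec {p + 1})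
      else if i = p + 1 then vscale (corner_off q p False True) (basis_vec {p}) +
        vscale (corner_diag q p False True) (basis_vec {p + 1})
      else vscale q (basis_vec {i}))"
  unfolding corner_op_basis_vec by (auto simp: corner_diag_def corner_off_def add.commute)

lemma sorted_list_of_set_split:
  assumes "finite I" "a \<in> I"
  obtains us vs where "sorted_list_of_set I = us @ a # vs" "sorted_wrt (<) (us @ a # vs)"
    "set us = {i \<in> I. i < a}" "set vs = {i \<in> I. a < i}"
proof -
  have "a \<in> set (sorted_list_of_set I)" using assms by simp
  then obtain us vs where split: "sorted_list_of_set I = us @ a # vs"
    by (auto dest: split_list)
  have sorted: "sorted_wrt (<) (us @ a # vs)"
    using strict_sorted_list_of_set[of I] by (simp only: split)
  have "I = set (us @ a # vs)" using assms(1) by (simp flip: split)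
  with sorted have "set us = {i \<in> I. i < a}" "set vs = {i \<in> I. a < i}"
    by (auto simp: sorted_wrt_append)
  with split sorted that show ?thesis by blast
qed

lemma sorted_list_of_set_eqI: "sorted_wrt (<) xs \<Longrightarrow> set xs = I \<Longrightarrow> sorted_list_of_set I = xs"
  using sorted_list_of_set.idem_if_sorted_distinct[of xs] strict_sorted_iff[of xs] by auto

text \<open>The coefficients are those of \<open>corner_op_basis_vec\<close>: this is the
  intertwining property for one generator on one basis vector.\<close>

lemma wedge_op_wedge_basis:
  assumes q: "q \<noteq> 0" and p: "p \<ge> 1" "qnum q p \<noteq> 0" and I: "finite I" "card I = l"
  shows "wedge_op q l p (wedge_basis I) =
    vscale (corner_diag q p (p \<in> I) (p + 1 \<in> I)) (wedge_basis I) +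
    vscale (corner_off q p (p \<in> I) (p + 1 \<in> I)) (wedge_basis (Transposition.transpose p (p + 1) ` I))"
proof -
  let ?is = "sorted_list_of_set I" and ?e = "\<lambda>i::nat. basis_vec {i}" and ?T = "corner_op q p"
  let ?f = "\<lambda>i. ?T (?e i)"
  have outside: "?f i = vscale q (?e i)" if "i \<notin> {p, p + 1}" for i
    using that by (simp add: corner_op_singleton)
  have len: "length ?is = l" using I by simp
  have op: "wedge_op q l p (wedge_basis I) = vscale (q powi (1 - int l)) (wedge (map ?f ?is))"
    using wedge_op_wedge[of q "map ?e ?is" p] len by (simp add: wedge_basis_def comp_def)
  have power: "q powi (1 - int l) * q ^ n = q powi (1 - int l + int n)" for n
    using q power_int_add[of q "1 - int l" "int n"] by simp
  \<comment> \<open>In the case \<open>one\<close>, \<open>a\<close> is the member of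
    \<open>{p, p + 1}\<close> in \<open>I\<close> and \<open>b\<close> the other; both orders are
    treated together.\<close>
  consider (none) "p \<notin> I" "p + 1 \<notin> I" | (one) a b where "a \<in> I" "b \<notin> I" "(a, b) = (p, p + 1) \<or> (a, b) = (p + 1, p)"
    | (both) "p \<in> I" "p + 1 \<in> I" by blast
  then show ?thesis
  proof cases
    case none
    have "wedge (map ?f (?is @ [] @ [])) = vscale (q ^ (length ?is + length ([] :: nat list))) (wedge (map ?e ?is @ map ?f [] @ map ?e []))"
      by (intro wedge_map_scale_outside[where K = "{p, p + 1}"] outside) (use none I in auto)
    then have "wedge_op q l p (wedge_basis I) = vscale (q powi (1 - int l) * q ^ l) (wedge_basis I)"
      using len unfolding op by (simp add: wedge_basis_def)
    then show ?thesis
      using none power[of l] by (simp add: corner_diag_def corner_off_def)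
  next
    case one
    obtain us vs where split: "?is = us @ a # vs" "sorted_wrt (<) (us @ a # vs)"
      "set us = {i \<in> I. i < a}" "set vs = {i \<in> I. a < i}"
      using sorted_list_of_set_split[OF I(1) one(1)] by blast
    have image: "Transposition.transpose p (p + 1) ` I = insert b (I - {a})"
      using one unfolding set_eq_iff in_transpose_image_iff
      by (auto simp: Transposition.transpose_def split: if_splits)
    \<comment> \<open>No integer lies strictly between \<open>a\<close> and \<open>b\<close>, and
      \<open>b\<close> is not in \<open>I\<close>; so \<open>b\<close> can take the place of
      \<open>a\<close> in the sorted list.\<close>
    have gap: "i \<in> I \<Longrightarrow> i < a \<Longrightarrow> i < b" "i \<in> I \<Longrightarrow> a < i \<Longrightarrow> b < i" for i
    proof -
      assume "i \<in> I"
      with one have "i \<noteq> b" by blast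
      then show "i < a \<Longrightarrow> i < b" "a < i \<Longrightarrow> b < i" using one(3) by auto
    qed
    have "\<forall>i\<in>set us. i < b" "\<forall>i\<in>set vs. b < i"
      using gap by (simp_all add: split(3,4))
    with split(2) have "sorted_wrt (<) (us @ b # vs)"
      by (simp add: sorted_wrt_append)
    moreover have "set (us @ b # vs) = insert b (I - {a})"
      using one(1,2) unfolding set_append list.set split(3,4) by auto
    ultimately have sorted_b: "sorted_list_of_set (insert b (I - {a})) = us @ b # vs"
      by (rule sorted_list_of_set_eqI)
    have disj: "set us \<inter> {p, p + 1} = {}" "set vs \<inter> {p, p + 1} = {}"
      unfolding split(3,4) using one by auto
    have "wedge (map ?f (us @ [a] @ vs)) = vscale (q ^ (length us + length vs)) (wedge (map ?e us @ map ?f [a] @ map ?e vs))"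
      using one(3) by (intro wedge_map_scale_outside[OF disj] outside) auto
    \<comment> \<open>All factors but one lie outside the block, and their power of \<open>q\<close>
      cancels the normalization.\<close>
    moreover have "int (length us + length vs) = int l - 1"
      using len split(1) by simp
    ultimately have "wedge_op q l p (wedge_basis I) = wedge (map ?e us @ ?f a # map ?e vs)"
      using power[of "length us + length vs"] by (simp add: op split(1))
    also have "?f a = vscale (corner_diag q p (p \<in> I) (p + 1 \<in> I)) (?e a)
        + vscale (corner_off q p (p \<in> I) (p + 1 \<in> I)) (?e b)"
      using one by (auto simp: corner_op_singleton add.commute)
    finally show ?thesis
      unfolding image by (simp add: wedge_add wedge_scale wedge_basis_def split(1) sorted_b)
  next
    case both
    obtain us ws where split: "?is = us @ p # ws" "sorted_wrt (<) (us @ p # ws)"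
      "set us = {i \<in> I. i < p}" "set ws = {i \<in> I. p < i}"
      using sorted_list_of_set_split[OF I(1) both(1)] by blast
    \<comment> \<open>\<open>ws\<close> is increasing, lies above \<open>p\<close> and contains
      \<open>p + 1\<close>, so it starts with \<open>p + 1\<close>.\<close>
    have "p + 1 \<in> set ws" using split(4) both by simp
    then obtain w vs where ws: "ws = w # vs" by (cases ws) auto
    have "sorted_wrt (<) (w # vs)" using split(2) ws by (simp add: sorted_wrt_append)
    moreover have "p < w" using split(4) ws by auto
    ultimately have w: "w = p + 1" "set vs \<inter> {p, p + 1} = {}"
      using \<open>p + 1 \<in> set ws\<close> ws by auto
    have disj: "set us \<inter> {p, p + 1} = {}"
      using split(3) by auto
    have "wedge (map ?f (us @ [p, p + 1] @ vs)) =
        vscale (q ^ (length us + length vs)) (wedge (map ?e us @ map ?f [p, p + 1] @ map ?e vs))"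
      by (intro wedge_map_scale_outside[OF disj w(2)] outside) auto
    moreover have "int (length us + length vs) = int l - 2"
      using len split(1) ws by simp
    ultimately have "wedge_op q l p (wedge_basis I) =
        vscale (inverse q) (wedge (map ?e us @ ?f p # ?f (p + 1) # map ?e vs))"
      using power[of "length us + length vs"] by (simp add: op split(1) ws w power_int_minus)
    \<comment> \<open>The block acts on its two factors through its determinant.\<close>
    also have "wedge (map ?e us @ ?f p # ?f (p + 1) # map ?e vs) = vscale (- 1) (wedge_basis I)"
      using corner_det[OF q p, of True]
      by (simp add: corner_op_singleton wedge_det_two wedge_basis_def split(1) ws w)
    finally show ?thesis
      using both by (simp add: corner_diag_def corner_off_def)
  qed
qed

text \<open>The intertwining relation for generators, phrased with the inverse of
  \<open>\<iota>\<close>; linearity reduces it to increasing wedges.\<close>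

lemma wedge_op_wedge_expand:
  assumes "q \<noteq> 0" "p \<ge> 1" "qnum q p \<noteq> 0" and z: "z \<in> corner_space k l"
  shows "wedge_op q l p (wedge_expand z) = wedge_expand (corner_op q p z)"
proof -
  have "wedge_op q l p (wedge_expand z) = lin_ext (\<lambda>I. wedge_op q l p (wedge_basis I)) z"
    unfolding wedge_expand_def by (rule linear_comp_lin_ext[OF linear_wedge_op])
  also have "\<dots> = lin_ext (\<lambda>I. wedge_expand (corner_op q p (basis_vec I))) z"
    unfolding lin_ext_def
  proof (intro sum.cong refl arg_cong[where f = "vscale _"])
    fix I assume "I \<in> Poly_Mapping.keys z"
    then have "I \<in> corner_index k l" using z by (auto simp: corner_space_def free_space_def)
    then have "finite I" "card I = l" by (auto intro: corner_index_finite simp: corner_index_def)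
    then show "wedge_op q l p (wedge_basis I) = wedge_expand (corner_op q p (basis_vec I))"
      unfolding corner_op_basis_vec
      by (simp add: wedge_op_wedge_basis[OF assms(1-3)] lin_add[OF linear_wedge_expand] lin_scale[OF linear_wedge_expand])
        (simp add: wedge_expand_def)
  qed
  also have "\<dots> = wedge_expand (corner_op q p z)"
    by (simp add: linear_comp_lin_ext[OF linear_wedge_expand, symmetric] linear_eq_lin_ext[OF linear_corner_op, symmetric])
  finally show ?thesis .
qed

text \<open>Linearity of \<open>\<iota>\<close> is available only on the wedge space, so the sum
  over the support is built up by induction while membership is tracked.\<close>

lemma corner_iota_wedge_expand:
  assumes "corner_iota k l \<iota>" "l \<ge> 1" and z: "z \<in> corner_space k l"
  shows "\<iota> (wedge_expand z) = z"
proof -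
  have lin: "linear_map_on (corner_wedge_space k l) (corner_space k l) \<iota>"
    using assms(1) by (simp add: corner_iota_def)
  have keys: "Poly_Mapping.keys z \<subseteq> corner_index k l"
    using z by (simp add: corner_space_def free_space_def)
  have basis: "\<iota> (wedge_basis I) = basis_vec I" if "I \<in> corner_index k l" for I
    using assms(1) that corner_index_finite[OF that]
    unfolding corner_iota_def wedge_basis_def by (auto simp: corner_index_def)
  have expand: "wedge_expand x \<in> corner_wedge_space k l" if "x \<in> corner_space k l" for x
    using that by (simp add: wedge_space_eq[OF assms(2)])
  have "\<iota> (wedge_expand (\<Sum>I\<in>A. vscale (Poly_Mapping.lookup z I) (basis_vec I))) =
      (\<Sum>I\<in>A. vscale (Poly_Mapping.lookup z I) (basis_vec I)) \<and>
      (\<Sum>I\<in>A. vscale (Poly_Mapping.lookup z I) (basis_vec I)) \<in> corner_space k l"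
    if "finite A" "A \<subseteq> corner_index k l" for A
    using that
  proof (induction A rule: finite_induct)
    case empty
    have 0: "0 \<in> corner_wedge_space k l"
      using expand[of 0] by (simp add: corner_space_def free_space_0 wedge_expand_def lin_ext_def)
    \<comment> \<open>Scaling by zero yields \<open>\<iota> 0 = 0\<close>.\<close>
    then have "\<iota> (vscale 0 0) = vscale 0 (\<iota> 0)"
      using lin by (simp only: linear_map_on_def)
    then show ?case
      by (simp add: corner_space_def free_space_0 wedge_expand_def lin_ext_def)
  next
    case (insert I A)
    let ?v = "basis_vec I" and ?c = "Poly_Mapping.lookup z I"
    have I: "?v \<in> corner_space k l" using insert.prems by (simp add: corner_space_def)
    then have cv: "vscale ?c ?v \<in> corner_space k l"
      by (simp add: corner_space_def free_space_scale)
    have "\<iota> (wedge_expand (vscale ?c ?v)) = vscale ?c (\<iota> (wedge_expand ?v))"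
      using lin expand[OF I] by (simp add: lin_scale[OF linear_wedge_expand] linear_map_on_def)
    also have "\<iota> (wedge_expand ?v) = ?v"
      using basis insert.prems by (simp add: wedge_expand_def)
    finally have "\<iota> (wedge_expand (vscale ?c ?v)) = vscale ?c ?v" .
    then show ?case
      using insert cv expand lin
      by (simp add: lin_add[OF linear_wedge_expand] linear_map_on_def corner_space_def free_space_add)
  qed
  from this[OF finite_keys keys] show ?thesis
    using linear_eq_lin_ext[OF linearI[of "\<lambda>x. x"], of z] by (simp add: lin_ext_def)
qed

section \<open>Existence of \<open>\<iota>\<close> and of the exterior power representation\<close>

lemma linear_map_on_inv_wedge_expand:
  assumes "l \<ge> 1"
  shows "linear_map_on (corner_wedge_space k l) (corner_space k l) (inv_into (corner_space k l) wedge_expand)"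
proof -
  have add: "x + y \<in> corner_space k l" and scale: "vscale c x \<in> corner_space k l"
    if "x \<in> corner_space k l" "y \<in> corner_space k l" for x y c
    using that by (auto simp: corner_space_def free_space_add free_space_scale)
  show ?thesis
    unfolding linear_map_on_def wedge_space_eq[OF assms]
    by (auto simp: inv_into_f_f[OF inj_on_wedge_expand] add scale
        simp flip: lin_add[OF linear_wedge_expand] lin_scale[OF linear_wedge_expand])
qed

lemma corner_iota_exists:
  assumes "l \<ge> 1"
  shows "corner_iota k l (inv_into (corner_space k l) wedge_expand)"
  unfolding corner_iota_def
proof (intro conjI allI impI linear_map_on_inv_wedge_expand assms)
  fix ns :: "nat list" assume ns: "length ns = l \<and> sorted_wrt (<) ns \<and> set ns \<subseteq> {2..k + l + 1}"
  then have "basis_vec (set ns) \<in> corner_space k l"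
    using strict_sorted_iff[of ns] by (simp add: corner_space_def corner_index_def distinct_card)
  moreover have "wedge (map (\<lambda>i. basis_vec {i}) ns) = wedge_expand (basis_vec (set ns))"
    using ns by (simp add: wedge_expand_def wedge_basis_def sorted_list_of_set_eqI[of ns "set ns"])
  ultimately show "inv_into (corner_space k l) wedge_expand (wedge (map (\<lambda>i. basis_vec {i}) ns)) = basis_vec (set ns)"
    by (simp add: inv_into_f_f[OF inj_on_wedge_expand])
qed

text \<open>Conjugation of \<open>\<rho>\<close> by \<open>wedge_expand\<close> keeps the module
  axioms, and \<open>wedge_op_wedge_expand\<close> identifies the generators.\<close>

lemma wedge_rep_exists:
  assumes "l \<ge> 1" "q \<noteq> 0" "\<And>p. p \<in> {1..k + l} \<Longrightarrow> qnum q p \<noteq> 0" and \<rho>: "corner_rep q k l \<rho>"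
  shows "wedge_rep q k l (\<lambda>h w. wedge_expand (\<rho> h (inv_into (corner_space k l) wedge_expand w)))"
proof -
  have sigma: "\<rho> (sigma q (k + l) p) w = corner_op q p w"
    if "w \<in> corner_space k l" "p \<in> {1..k + l}" for w p
    using \<rho> that by (auto simp: corner_rep_def)
  have closed: "\<rho> h x \<in> corner_space k l" if "h \<in> carrier (hecke_algebra q (k + l))" "x \<in> corner_space k l" for h x
    using \<rho> that unfolding corner_rep_def hecke_rep_def linear_map_on_def by blast
  have add: "x + y \<in> corner_space k l" and scale: "vscale c x \<in> corner_space k l"
    if "x \<in> corner_space k l" "y \<in> corner_space k l" for x y c
    using that by (auto simp: corner_space_def free_space_add free_space_scale)
  note inv = inv_into_f_f[OF inj_on_wedge_expand]
  note flip = lin_add[OF linear_wedge_expand, symmetric] lin_scale[OF linear_wedge_expand, symmetric]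
  have "hecke_rep q (k + l) (corner_wedge_space k l) (\<lambda>h w. wedge_expand (\<rho> h (inv_into (corner_space k l) wedge_expand w)))"
    using \<rho> closed unfolding wedge_space_eq[OF assms(1)] corner_rep_def hecke_rep_def linear_map_on_def
    by (auto simp: inv add scale flip)
  moreover have "wedge_expand (\<rho> (sigma q (k + l) p) (inv_into (corner_space k l) wedge_expand w)) = wedge_op q l p w"
    if "p \<in> {1..k + l}" "w \<in> corner_wedge_space k l" for p w
    using that assms(2,3) by (auto simp: wedge_space_eq[OF assms(1)] inv sigma wedge_op_wedge_expand)
  ultimately show ?thesis by (simp add: wedge_rep_def)
qed

theorem proposition4p4:
  fixes q :: complex and k l :: nat
  assumes "l \<ge> 1"
    and "q \<noteq> 0"
    and "(\<Prod>p = 1..k + l. qnum q p) \<noteq> 0"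
  shows "(\<exists>\<rho>'. wedge_rep q k l \<rho>') \<and> (\<exists>\<rho>. corner_rep q k l \<rho>) \<and> (\<exists>\<iota>. corner_iota k l \<iota>) \<and>
    (\<forall>\<rho>' \<rho> \<iota>. wedge_rep q k l \<rho>' \<and> corner_rep q k l \<rho> \<and> corner_iota k l \<iota> \<longrightarrow>
       bij_betw \<iota> (corner_wedge_space k l) (corner_space k l) \<and>
       (\<forall>h\<in>carrier (hecke_algebra q (k + l)). \<forall>w\<in>corner_wedge_space k l.
          \<iota> (\<rho>' h w) = \<rho> h (\<iota> w)))"
proof (intro conjI allI impI ballI)
  have qnum: "qnum q p \<noteq> 0" if "p \<in> {1..k + l}" for p
    using assms(3) that by simp
  interpret hecke_operators q "k + l" "corner_op q"
    using assms(2,3) by (rule hecke_operators_corner_op)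
  have rep: "corner_rep q k l hecke_action"
    using hecke_rep_hecke_action[of "corner_index k l"] corner_op_closed[of _ k l]
    by (simp add: corner_rep_def hecke_action_sigma corner_space_def)
  then show "\<exists>\<rho>. corner_rep q k l \<rho>" by blast
  show "\<exists>\<rho>'. wedge_rep q k l \<rho>'"
    using wedge_rep_exists[OF assms(1,2) qnum rep] by blast
  show "\<exists>\<iota>. corner_iota k l \<iota>"
    using corner_iota_exists[OF assms(1)] by blast
  fix \<rho>' \<rho> \<iota> assume asm: "wedge_rep q k l \<rho>' \<and> corner_rep q k l \<rho> \<and> corner_iota k l \<iota>"
  note inverse = corner_iota_wedge_expand[OF _ assms(1), of k \<iota>]
  show "bij_betw \<iota> (corner_wedge_space k l) (corner_space k l)"
    \<comment> \<open>\<open>wedge_expand\<close> maps the corner space onto the wedge space, and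
      \<open>\<iota>\<close> undoes it.\<close>
    unfolding wedge_space_eq[OF assms(1)]
    using asm by (intro bij_betw_byWitness[where f' = wedge_expand]) (auto simp: inverse)
  fix h w assume h: "h \<in> carrier (hecke_algebra q (k + l))" and w: "w \<in> corner_wedge_space k l"
  show "\<iota> (\<rho>' h w) = \<rho> h (\<iota> w)"
  \<comment> \<open>Only generators have to be checked, on vectors of the form
    \<open>wedge_expand z\<close>.\<close>
  proof (rule hecke_rep_intertwining[OF _ _ _ _ h w])
    fix p v assume p: "p \<in> {1..k + l}" and v: "v \<in> corner_wedge_space k l"
    then obtain z where z: "z \<in> corner_space k l" "v = wedge_expand z"
      by (auto simp: wedge_space_eq[OF assms(1)])
    then have "\<iota> (\<rho>' (sigma q (k + l) p) v) = \<iota> (wedge_expand (corner_op q p z))"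
      using asm p v qnum[OF p] assms(2) by (simp add: wedge_rep_def wedge_op_wedge_expand)
    also have "\<dots> = corner_op q p z"
      using asm corner_op_closed[OF p z(1)] by (simp add: inverse)
    also have "\<dots> = \<rho> (sigma q (k + l) p) (\<iota> v)"
      using asm z p by (simp add: corner_rep_def inverse)
    finally show "\<iota> (\<rho>' (sigma q (k + l) p) v) = \<rho> (sigma q (k + l) p) (\<iota> v)" .
  qed (use asm in \<open>auto simp: wedge_rep_def corner_rep_def corner_iota_def\<close>)
qed

end
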